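(* Let $f: \mathbb{Z}^n \to \mathbb{R} \cup \{+\infty\}$ with $\operatorname{dom} f \neq \emptyset$, and assume that its convex envelope $\overline{f}$ is a polyhedral convex function and that $\overline{f}(x) = f(x)$ for all $x \in \mathbb{Z}^n$. Then $f$ is integrally convex if and only if $\arg\min f[-p]$ is an integrally convex set for each $p \in \mathbb{R}^n$ for which $f[-p]$ attains a (finite) minimum.
   Context: $\operatorname{dom} f = \{x \in \mathbb{Z}^n \mid f(x) < +\infty\}$. The convex envelope of $f$ is $\overline{f}(x) = \sup\{ \langle p,x\rangle + \alpha \mid p \in \mathbb{R}^n, \alpha \in \mathbb{R},\ \langle p,y\rangle + \alpha \le f(y)\ \forall y \in \mathbb{Z}^n\}$ for $x \in \mathbb{R}^n$ ($f$ is assumed to be minorized by some affine function). For $p \in \mathbb{R}^n$, $f[-p](x) = f(x) - \langle p, x\rangle$ for $x \in \mathbb{Z}^n$, and $\arg\min f[-p] = \{x \in \mathbb{Z}^n \mid f[-p](x) \le f[-p](y)\ \forall y \in \mathbb{Z}^n\}$. For $T \subseteq \mathbb{R}^n$, $\overline{T}$ is its convex hull; $N(x) = \{ z \in \mathbb{Z}^n \mid |x_i - z_i| < 1 \ (i=1,\dots,n)\}$. A nonempty $S \subseteq \mathbb{Z}^n$ is integrally convex if every $x \in \overline{S}$ satisfies $x \in \overline{S \cap N(x)}$. The local convex extension of $f$ is $\tilde f(x) = \min\{ \sum_{y \in N(x)} \lambda_y f(y) \mid \sum_{y \in N(x)} \lambda_y y = x,\ \sum \lambda_y = 1,\ \lambda_y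 \ge 0\}$, and $f$ is integrally convex if $\tilde f$ is convex on $\mathbb{R}^n$. *)

theory Defs
  imports "HOL-Analysis.Analysis"
begin

text \<open>Functions from \<open>\<int>\<^sup>n\<close> to \<open>\<real> \<union> {+\<infinity>}\<close> are rendered as functions \<open>int ^ 'n \<Rightarrow> ereal\<close> that never
  take the value \<open>-\<infinity>\<close>.\<close>

definition emb :: "int ^ 'n::finite \<Rightarrow> real ^ 'n" where
  "emb z = (\<chi> i. real_of_int (z $ i))"

definition edom :: "(int ^ 'n::finite \<Rightarrow> ereal) \<Rightarrow> (int ^ 'n) set" where
  "edom f = {x. f x < \<infinity>}"

definition affine_minorant :: "(int ^ 'n::finite \<Rightarrow> ereal) \<Rightarrow> real ^ 'n \<Rightarrow> real \<Rightarrow> bool" where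
  "affine_minorant f p \<alpha> \<longleftrightarrow> (\<forall>y. ereal (p \<bullet> emb y + \<alpha>) \<le> f y)"

definition convex_envelope :: "(int ^ 'n::finite \<Rightarrow> ereal) \<Rightarrow> real ^ 'n \<Rightarrow> ereal" where
  "convex_envelope f x = Sup {ereal (p \<bullet> x + \<alpha>) | p \<alpha>. affine_minorant f p \<alpha>}"

definition epigraph :: "(real ^ 'n::finite \<Rightarrow> ereal) \<Rightarrow> ((real ^ 'n) \<times> real) set" where
  "epigraph g = {(x, t). g x \<le> ereal t}"

definition polyhedral_convex_fun :: "(real ^ 'n::finite \<Rightarrow> ereal) \<Rightarrow> bool" where
  "polyhedral_convex_fun g \<longleftrightarrow> polyhedron (epigraph g)"

definition convex_fun :: "(real ^ 'n::finite \<Rightarrow> ereal) \<Rightarrow> bool" where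
  "convex_fun g \<longleftrightarrow>
     (\<forall>x y. \<forall>t::real. 0 < t \<and> t < 1 \<longrightarrow>
        g ((1 - t) *\<^sub>R x + t *\<^sub>R y) \<le> ereal (1 - t) * g x + ereal t * g y)"

definition tilt :: "(int ^ 'n::finite \<Rightarrow> ereal) \<Rightarrow> real ^ 'n \<Rightarrow> int ^ 'n \<Rightarrow> ereal" where
  "tilt f p x = f x - ereal (p \<bullet> emb x)"

definition argmin_set :: "(int ^ 'n::finite \<Rightarrow> ereal) \<Rightarrow> (int ^ 'n) set" where
  "argmin_set g = {x. \<forall>y. g x \<le> g y}"

definition attains_finite_min :: "(int ^ 'n::finite \<Rightarrow> ereal) \<Rightarrow> bool" where
  "attains_finite_min g \<longleftrightarrow> (\<exists>x \<in> argmin_set g. \<bar>g x\<bar> \<noteq> \<infinity>)"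

definition int_nbhd :: "real ^ 'n::finite \<Rightarrow> (int ^ 'n) set" where
  "int_nbhd x = {z. \<forall>i. \<bar>x $ i - real_of_int (z $ i)\<bar> < 1}"

definition integrally_convex_set :: "(int ^ 'n::finite) set \<Rightarrow> bool" where
  "integrally_convex_set S \<longleftrightarrow>
     S \<noteq> {} \<and> (\<forall>x \<in> convex hull (emb ` S). x \<in> convex hull (emb ` (S \<inter> int_nbhd x)))"

text \<open>Since \<open>int_nbhd x\<close> is finite and its convex hull contains \<open>x\<close>, the infimum below ranges over a
  nonempty compact set of coefficients and is attained when \<open>f\<close> avoids \<open>-\<infinity>\<close>.  In \<^typ>\<open>ereal\<close> one has
  \<open>0 * \<infinity> = 0\<close>, so points with zero coefficient do not contribute.\<close>

definition local_convex_ext :: "(int ^ 'n::finite \<Rightarrow> ereal) \<Rightarrow> real ^ 'n \<Rightarrow> ereal" where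
  "local_convex_ext f x =
     Inf {(\<Sum>y\<in>int_nbhd x. ereal (c y) * f y) | c :: int ^ 'n \<Rightarrow> real.
            (\<Sum>y\<in>int_nbhd x. c y *\<^sub>R emb y) = x \<and>
            (\<Sum>y\<in>int_nbhd x. c y) = 1 \<and>
            (\<forall>y\<in>int_nbhd x. 0 \<le> c y)}"

definition integrally_convex_fun :: "(int ^ 'n::finite \<Rightarrow> ereal) \<Rightarrow> bool" where
  "integrally_convex_fun f \<longleftrightarrow> convex_fun (local_convex_ext f)"

end

theory Submission
  imports Defs
begin

text \<open>
  Let \<open>F\<close> be the convex envelope of \<open>f\<close>.  For an affine minorant \<open>p \<bullet> x + \<alpha>\<close> of \<open>f\<close> that is tight
  somewhere, \<open>arg min f[-p]\<close> is its contact set with \<open>f\<close>.  If the local extension is convex, it lies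
  below the affine function on the hull of the contact set; as the minimum defining it is attained,
  it is attained at contact points only.

  For the converse one shows that the local extension equals \<open>F\<close>, and the point is that every \<open>x\<close> with
  \<open>F x < \<infinity>\<close> lies in the hull of the contact set of a minorant tight at \<open>x\<close>.  This is not automatic,
  since \<open>F\<close> is only the closure of the convex hull of \<open>f\<close>, and a linearity domain of \<open>F\<close> with irrational
  recession directions may contain too few integer points.  Integral convexity excludes this:
  the hull \<open>C\<close> of an integrally convex set \<open>S\<close> is the intersection of the translated cones
  \<open>z + K z\<close>, where \<open>K z\<close> is generated by the steps \<open>v \<in> {-1,0,1}\<^sup>n\<close> with \<open>z + v \<in> S\<close>.  Only finitely many
  cones occur, so \<open>C\<close> is a polyhedron with recession cone the intersection of the \<open>K z\<close>, and
  passing to faces shows that this recession cone is generated by integer vectors.  Since \<open>F\<close> is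
  polyhedral, finitely many contact sets cover the domain of \<open>f\<close>; their vertices and integer recession
  directions generate a closed convex set that contains the epigraph of \<open>F\<close>, and an integer
  recession direction along which the tight minorant has the right slope maps its contact set
  into itself.
\<close>

section \<open>Recession cones and polyhedra\<close>

text \<open>On a nonempty closed convex set this is the usual recession cone; on the empty set it is
  the whole space.\<close>

definition rec_cone :: "'a::real_vector set \<Rightarrow> 'a set" where
  "rec_cone T = {d. \<forall>y\<in>T. \<forall>t\<ge>0. y + t *\<^sub>R d \<in> T}"

lemma rec_coneD: "d \<in> rec_cone T \<Longrightarrow> y \<in> T \<Longrightarrow> 0 \<le> t \<Longrightarrow> y + t *\<^sub>R d \<in> T"
  by (simp add: rec_cone_def)

lemma convex_cone_rec_cone: "convex_cone (rec_cone T)"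
  unfolding convex_cone_iff
proof (intro conjI ballI allI impI)
  show "0 \<in> rec_cone T" by (simp add: rec_cone_def)
next
  fix x y assume "x \<in> rec_cone T" "y \<in> rec_cone T"
  then show "x + y \<in> rec_cone T"
    by (simp add: rec_cone_def scaleR_add_right add.assoc [symmetric])
next
  fix x and c :: real assume "x \<in> rec_cone T" "0 \<le> c"
  then show "c *\<^sub>R x \<in> rec_cone T"
    by (simp add: rec_cone_def)
qed

lemma convex_cone_sum:
  assumes "convex_cone K" "finite I" "\<And>i. i \<in> I \<Longrightarrow> h i \<in> K"
  shows "sum h I \<in> K"
  using assms(2,3)
  by (induction I rule: finite_induct)
    (auto intro: convex_cone_add[OF assms(1)] convex_cone_contains_0[OF assms(1)])

lemma convex_hull_plus_cone_subset:
  assumes "convex T" "B \<subseteq> T" "W \<subseteq> rec_cone T"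
    and "x \<in> convex hull B" "y \<in> convex_cone hull W"
  shows "x + y \<in> T"
proof -
  have "x \<in> T" using assms(1,2,4) hull_minimal by blast
  moreover have "y \<in> rec_cone T"
    using assms(3,5) convex_cone_rec_cone hull_minimal by blast
  ultimately show ?thesis using rec_coneD[of y T x 1] by simp
qed

text \<open>In a closed convex set one ray decides: convexity fills the gaps between its integer
  points, and \<open>y + t d\<close> is a limit of points on segments from \<open>y\<close> to ever
  more distant points of the ray.\<close>

lemma rec_cone_if_ray:
  fixes T :: "'a::real_normed_vector set"
  assumes "closed T" "convex T" "z \<in> T" and ray: "\<And>N::nat. z + real N *\<^sub>R d \<in> T"
  shows "d \<in> rec_cone T"
  unfolding rec_cone_def
proof (clarify)
  fix y and t :: real assume y: "y \<in> T" and t: "0 \<le> t"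
  have ray': "z + s *\<^sub>R d \<in> T" if "0 \<le> s" for s
  proof (cases "s = 0")
    case False
    obtain N where N: "s \<le> real N" using real_arch_simple by blast
    have "real N > 0" using N False that by linarith
    then have "z + s *\<^sub>R d = (1 - s / N) *\<^sub>R z + (s / N) *\<^sub>R (z + real N *\<^sub>R d)"
      by (simp add: algebra_simps)
    also have "\<dots> \<in> T"
      using assms(2,3) ray[of N] N that \<open>real N > 0\<close> by (intro convexD_alt) auto
    finally show ?thesis .
  qed (use assms in simp)
  define g where "g = (\<lambda>k::nat. (1 - inverse (real (Suc k))) *\<^sub>R y
      + inverse (real (Suc k)) *\<^sub>R (z + (t * real (Suc k)) *\<^sub>R d))"
  have "g k \<in> T" for k
    unfolding g_def using assms(2) y ray'[of "t * real (Suc k)"] t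
    by (intro convexD_alt) (auto simp del: of_nat_Suc simp: divide_simps)
  moreover have "g \<longlonglongrightarrow> y + t *\<^sub>R d"
  proof -
    have "g = (\<lambda>k. (1 - inverse (real (Suc k))) *\<^sub>R y + inverse (real (Suc k)) *\<^sub>R z + t *\<^sub>R d)"
      unfolding g_def by (rule ext) (simp add: scaleR_add_right)
    moreover have "\<dots> \<longlonglongrightarrow> (1 - 0) *\<^sub>R y + 0 *\<^sub>R z + t *\<^sub>R d"
      by (intro tendsto_intros LIMSEQ_inverse_real_of_nat)
    ultimately show ?thesis by simp
  qed
  ultimately show "y + t *\<^sub>R d \<in> T"
    using closed_sequentially[OF assms(1)] by blast
qed

text \<open>Strictly between two points where \<open>g\<close> is nonnegative and not both times
  zero, \<open>g\<close> is positive; otherwise both ends lie in \<open>A\<close>. Using such a set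
  as the container in hull arguments keeps track of the equality case.\<close>

lemma convex_strict_side_Un:
  fixes g :: "'a::real_vector \<Rightarrow> real"
  assumes aff: "\<And>x y t. g ((1 - t) *\<^sub>R x + t *\<^sub>R y) = (1 - t) * g x + t * g y"
    and "convex A" and A: "\<And>x. x \<in> A \<Longrightarrow> g x = 0"
  shows "convex ({x. g x > 0} \<union> A)"
  unfolding convex_alt
proof (intro ballI allI impI)
  fix x y and t :: real
  assume x: "x \<in> {x. g x > 0} \<union> A" and y: "y \<in> {x. g x > 0} \<union> A" and t: "0 \<le> t \<and> t \<le> 1"
  let ?z = "(1 - t) *\<^sub>R x + t *\<^sub>R y"
  show "?z \<in> {x. g x > 0} \<union> A"
  proof (cases "t = 0 \<or> t = 1 \<or> (x \<in> A \<and> y \<in> A)")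
    case True
    then show ?thesis using x y t \<open>convex A\<close> by (auto simp: convex_alt)
  next
    case False
    have ge: "g x \<ge> 0" "g y \<ge> 0" using x y A by fastforce+
    have "g x > 0 \<or> g y > 0" using False x y by auto
    then have "0 < (1 - t) * g x + t * g y"
      using False t ge by (auto intro: add_pos_nonneg add_nonneg_pos)
    then show ?thesis using aff by simp
  qed
qed

text \<open>The open side joined with the hull of the points at level \<open>\<beta>\<close> is
  convex and contains \<open>X\<close>, so it contains \<open>b\<close>, which is not on the open
  side. The set \<open>X\<close> may be infinite.\<close>

lemma convex_hull_level_face:
  fixes q :: "'a::real_inner"
  assumes "\<And>y. y \<in> X \<Longrightarrow> \<beta> \<le> q \<bullet> y" and "b \<in> convex hull X" and "q \<bullet> b \<le> \<beta>"
  shows "b \<in> convex hull {y \<in> X. q \<bullet> y = \<beta>}"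
proof -
  let ?A = "convex hull {y \<in> X. q \<bullet> y = \<beta>}"
  have A: "?A \<subseteq> {x. q \<bullet> x = \<beta>}"
    by (rule hull_minimal) (auto simp: convex_hyperplane)
  have "convex ({x. q \<bullet> x - \<beta> > 0} \<union> ?A)"
    by (rule convex_strict_side_Un) (use A in \<open>auto simp: algebra_simps\<close>)
  moreover have "X \<subseteq> {x. q \<bullet> x - \<beta> > 0} \<union> ?A"
  proof
    fix y assume "y \<in> X"
    then show "y \<in> {x. q \<bullet> x - \<beta> > 0} \<union> ?A"
      using assms(1)[of y] by (cases "q \<bullet> y = \<beta>") (auto intro: hull_inc)
  qed
  ultimately have "b \<in> {x. q \<bullet> x - \<beta> > 0} \<union> ?A"
    using assms(2) hull_minimal by blast
  then show ?thesis using assms(3) by auto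
qed

section \<open>Polyhedra as sums of a polytope and a cone\<close>

lemma polyhedron_halfspaces:
  fixes P :: "'a::euclidean_space set"
  assumes "polyhedron P"
  obtains A :: "('a \<times> real) set" where "finite A" "P = {x. \<forall>(a,b)\<in>A. a \<bullet> x \<le> b}"
proof -
  obtain F where F: "finite F" "P = \<Inter>F" "\<forall>h\<in>F. \<exists>a b. a \<noteq> 0 \<and> h = {x. a \<bullet> x \<le> b}"
    using assms unfolding polyhedron_def by blast
  then obtain a b where ab: "\<And>h. h \<in> F \<Longrightarrow> h = {x. a h \<bullet> x \<le> b h}" by metis
  show ?thesis
  proof (rule that[of "(\<lambda>h. (a h, b h)) ` F"])
    show "P = {x. \<forall>(a,b)\<in>(\<lambda>h. (a h, b h)) ` F. a \<bullet> x \<le> b}"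
      using F(2) ab by fastforce
  qed (use F in auto)
qed

text \<open>The half of the Minkowski-Weyl theorem that passes from half-spaces to
  generators.\<close>

lemma polyhedron_decomposition:
  fixes C :: "'a::euclidean_space set"
  assumes "polyhedron C" "C \<noteq> {}"
  obtains B R where "finite B" "B \<subseteq> C" "finite R" "R \<subseteq> rec_cone C"
    and "\<And>x. x \<in> C \<Longrightarrow> \<exists>b\<in>convex hull B. \<exists>r\<in>convex_cone hull R. x = b + r"
proof -
  obtain A where A: "finite A" "C = {x. \<forall>(a,b)\<in>A. a \<bullet> x \<le> b}"
    using polyhedron_halfspaces[OF assms(1)] by blast
  \<comment> \<open>The homogenisation of \<open>C\<close>: a box cuts it to a polytope, and vertices of positive and zero height
    yield \<open>B\<close> and \<open>R\<close>.\<close>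
  define K :: "('a \<times> real) set" where
    "K = {y. (0, -1) \<bullet> y \<le> 0} \<inter> \<Inter>((\<lambda>(a,b). {y. (a, -b) \<bullet> y \<le> 0}) ` A)"
  have K: "(x, s) \<in> K \<longleftrightarrow> 0 \<le> s \<and> (\<forall>(a,b)\<in>A. a \<bullet> x \<le> s * b)" for x s
    unfolding K_def by (auto simp: inner_prod_def mult.commute)
  have "polyhedron K"
    unfolding K_def using A(1) by (intro polyhedron_Int polyhedron_Inter) (auto intro: polyhedron_halfspace_le)
  then have "polytope (K \<inter> cbox (- One) One)"
    by (simp add: polytope_eq_bounded_polyhedron bounded_Int)
  then obtain J where J: "finite J" "K \<inter> cbox (- One) One = convex hull J"
    unfolding polytope_def by blast
  have JK: "J \<subseteq> K" using J(2) hull_subset[of J convex] by blast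
  define B where "B = (\<lambda>(x,s). x /\<^sub>R s) ` {y \<in> J. snd y > 0}"
  define R where "R = fst ` {y \<in> J. snd y = 0}"
  have BC: "B \<subseteq> C"
  proof
    fix y assume "y \<in> B"
    then obtain x s where xs: "(x, s) \<in> J" "s > 0" "y = x /\<^sub>R s" by (auto simp: B_def)
    then have "(x, s) \<in> K" using JK by blast
    with xs show "y \<in> C" unfolding A(2) K by (auto simp: field_simps)
  qed
  have RC: "R \<subseteq> rec_cone C"
  proof
    fix x assume "x \<in> R"
    then have "(x, 0) \<in> K" using JK by (auto simp: R_def)
    then have "a \<bullet> x \<le> 0" if "(a, b) \<in> A" for a b using that unfolding K by auto
    then have "a \<bullet> y + t * (a \<bullet> x) \<le> b" if "(a, b) \<in> A" "y \<in> C" "0 \<le> t" for a b y t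
      using that A(2) mult_nonneg_nonpos[of t "a \<bullet> x"] by fastforce
    then show "x \<in> rec_cone C"
      unfolding rec_cone_def using A(2) by (auto simp: inner_add_right)
  qed
  have "\<exists>b\<in>convex hull B. \<exists>r\<in>convex_cone hull R. x = b + r" if x: "x \<in> C" for x
  proof -
    define e where "e = inverse (1 + norm (x, 1::real))"
    have e: "0 < e" by (simp add: e_def add_pos_nonneg)
    have xK: "(x, 1) \<in> K" unfolding K using x A(2) by auto
    have "e *\<^sub>R (x, 1) \<in> K"
      using xK e unfolding K by (auto simp: K)
    moreover have "e *\<^sub>R (x, 1::real) \<in> cbox (- One) One"
    proof -
      have "norm (e *\<^sub>R (x, 1::real)) \<le> 1"
        unfolding e_def by (simp add: divide_simps add_pos_nonneg del: scaleR_Pair)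
      then have "\<bar>(e *\<^sub>R (x, 1::real)) \<bullet> i\<bar> \<le> 1" if "i \<in> Basis" for i
        using Basis_le_norm[OF that, of "e *\<^sub>R (x, 1::real)"] by linarith
      then show ?thesis by (auto simp: mem_box abs_le_iff simp del: scaleR_Pair)
    qed
    ultimately have "e *\<^sub>R (x, 1) \<in> convex hull J" using J(2) by blast
    then obtain u where u: "\<forall>j\<in>J. 0 \<le> u j" "sum u J = 1" "(\<Sum>j\<in>J. u j *\<^sub>R j) = e *\<^sub>R (x, 1)"
      using J(1) by (auto simp: convex_hull_finite)
    have ux: "(\<Sum>j\<in>J. u j *\<^sub>R fst j) = e *\<^sub>R x" "(\<Sum>j\<in>J. u j * snd j) = e"
      using arg_cong[OF u(3), of fst] arg_cong[OF u(3), of snd]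
      by (simp_all add: fst_sum snd_sum)
    have s0: "snd j \<ge> 0" if "j \<in> J" for j
      using that JK K[of "fst j" "snd j"] by auto
    let ?P = "{j\<in>J. snd j > 0}" and ?Z = "{j\<in>J. snd j = 0}"
    have JPZ: "J = ?P \<union> ?Z" "?P \<inter> ?Z = {}" using s0 by force+
    have fin: "finite ?P" "finite ?Z" using J(1) by auto
    have split: "sum h J = sum h ?P + sum h ?Z" for h :: "'a \<times> real \<Rightarrow> 'b::comm_monoid_add"
      using sum.union_disjoint[OF fin JPZ(2), of h] JPZ(1) by simp
    \<comment> \<open>A point of positive height is rescaled to height 1 and its weight multiplied
      by that height, so the weights add up to \<open>e / e = 1\<close>; points of height 0 go into
      \<open>r\<close>.\<close>
    define b where "b = (\<Sum>j\<in>?P. (u j * snd j / e) *\<^sub>R (fst j /\<^sub>R snd j))"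
    define r where "r = (\<Sum>j\<in>?Z. (u j / e) *\<^sub>R fst j)"
    have split2: "(\<Sum>j\<in>J. u j * snd j) = (\<Sum>j\<in>?P. u j * snd j)"
      using J(1) s0 by (intro sum.mono_neutral_right) force+
    have "b \<in> convex hull B"
      unfolding b_def
    proof (rule convex_sum[OF fin(1) convex_convex_hull])
      show "(\<Sum>j\<in>?P. u j * snd j / e) = 1"
        using ux(2) split2 e by (simp add: sum_divide_distrib [symmetric])
      show "0 \<le> u j * snd j / e" if "j \<in> ?P" for j using that u(1) e by auto
      show "fst j /\<^sub>R snd j \<in> convex hull B" if "j \<in> ?P" for j
        using that by (intro hull_inc) (force simp: B_def)
    qed
    moreover have "r \<in> convex_cone hull R"
      unfolding r_def
    proof (rule convex_cone_sum[OF convex_cone_convex_cone_hull fin(2)])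
      show "(u j / e) *\<^sub>R fst j \<in> convex_cone hull R" if "j \<in> ?Z" for j
        using that u(1) e by (intro convex_cone_hull_mul hull_inc) (auto simp: R_def)
    qed
    moreover have "b + r = x"
    proof -
      have "b = (\<Sum>j\<in>?P. (u j / e) *\<^sub>R fst j)"
        unfolding b_def by (rule sum.cong) auto
      then have "b + r = (\<Sum>j\<in>J. (u j / e) *\<^sub>R fst j)"
        unfolding r_def split by simp
      also have "\<dots> = (1 / e) *\<^sub>R (\<Sum>j\<in>J. u j *\<^sub>R fst j)"
        by (simp add: scaleR_sum_right)
      finally show ?thesis using ux(1) e by simp
    qed
    ultimately show ?thesis by blast
  qed
  moreover have "finite B" "finite R" using J(1) by (auto simp: B_def R_def)
  ultimately show ?thesis using that BC RC by blast
qed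

section \<open>Integrally convex sets and their local cones\<close>

lemma emb_nth [simp]: "emb z $ i = real_of_int (z $ i)"
  by (simp add: emb_def)

lemma emb_add: "emb (x + y) = emb x + emb y"
  by (simp add: vec_eq_iff)

lemma emb_diff: "emb (x - y) = emb x - emb y"
  by (simp add: vec_eq_iff)

lemma emb_eq_iff [simp]: "emb x = emb y \<longleftrightarrow> x = y"
  by (simp add: vec_eq_iff)

lemma zero_in_range_emb: "0 \<in> range emb"
proof
  show "0 = emb 0" by (simp add: vec_eq_iff)
qed simp

lemma scaleR_of_int_in_range_emb:
  assumes "x \<in> range emb" shows "real_of_int k *\<^sub>R x \<in> range emb"
proof -
  obtain z where "x = emb z" using assms by blast
  then have "real_of_int k *\<^sub>R x = emb (\<chi> i. k * z $ i)" by (simp add: vec_eq_iff)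
  then show ?thesis by blast
qed

lemma add_in_range_emb: "x \<in> range emb \<Longrightarrow> y \<in> range emb \<Longrightarrow> x + y \<in> range emb"
  by (auto simp: emb_add[symmetric])

lemma sum_in_range_emb:
  assumes "\<And>i. i \<in> I \<Longrightarrow> h i \<in> range emb" shows "sum h I \<in> range emb"
  using assms
  by (induction I rule: infinite_finite_induct)
    (auto intro: add_in_range_emb zero_in_range_emb)

lemma finite_int_box: "finite {v :: int ^ 'n::finite. \<forall>i. a i \<le> v $ i \<and> v $ i \<le> b i}"
proof -
  let ?X = "{v :: int ^ 'n. \<forall>i. a i \<le> v $ i \<and> v $ i \<le> b i}"
  have "?X \<subseteq> vec_lambda ` Pi UNIV (\<lambda>i. {a i..b i})"
  proof
    fix v assume "v \<in> ?X"
    then show "v \<in> vec_lambda ` Pi UNIV (\<lambda>i. {a i..b i})"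
      by (intro image_eqI[of _ _ "\<lambda>i. v $ i"]) auto
  qed
  moreover have "finite (Pi UNIV (\<lambda>i::'n. {a i..b i}))"
    using finite_PiE[of "UNIV :: 'n set" "\<lambda>i. {a i..b i}"] by (simp add: PiE_def)
  ultimately show ?thesis using finite_subset by blast
qed

lemma finite_int_points_near:
  "finite {z :: int ^ 'n::finite. \<forall>i. \<bar>x $ i - real_of_int (z $ i)\<bar> < r}"
proof (rule finite_subset)
  show "{z. \<forall>i. \<bar>x $ i - real_of_int (z $ i)\<bar> < r}
      \<subseteq> {z :: int ^ 'n. \<forall>i. \<lfloor>x $ i - r\<rfloor> \<le> z $ i \<and> z $ i \<le> \<lceil>x $ i + r\<rceil>}"
  proof clarify
    fix z :: "int ^ 'n" and i
    assume "\<forall>i. \<bar>x $ i - real_of_int (z $ i)\<bar> < r"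
    then have "\<bar>x $ i - real_of_int (z $ i)\<bar> < r" by blast
    then show "\<lfloor>x $ i - r\<rfloor> \<le> z $ i \<and> z $ i \<le> \<lceil>x $ i + r\<rceil>" by linarith
  qed
qed (rule finite_int_box)

lemma finite_int_nbhd: "finite (int_nbhd x)"
  unfolding int_nbhd_def by (rule finite_int_points_near)

text \<open>Points of the hull close to the limit \<open>l\<close> lie in the hull of those points
  of \<open>S\<close> that are less than 2 away from \<open>l\<close> in each coordinate. These are
  finitely many, so their hull is compact and contains \<open>l\<close>.\<close>

lemma closed_integrally_convex_hull:
  assumes "integrally_convex_set S"
  shows "closed (convex hull (emb ` S))"
proof (rule closed_sequential_limits[THEN iffD2], intro allI impI, elim conjE)
  fix x l assume x: "\<forall>k. x k \<in> convex hull (emb ` S)" and lim: "x \<longlonglongrightarrow> l"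
  let ?T = "S \<inter> {z. \<forall>i. \<bar>l $ i - real_of_int (z $ i)\<bar> < 2}"
  have "\<forall>\<^sub>F k in sequentially. dist (x k) l < 1"
    using lim by (simp add: tendstoD)
  moreover have "x k \<in> convex hull (emb ` ?T)" if "dist (x k) l < 1" for k
  proof -
    have "\<bar>x k $ i - l $ i\<bar> < 1" for i
      using component_le_norm_cart[of "x k - l" i] that by (simp add: dist_norm)
    then have "int_nbhd (x k) \<subseteq> {z. \<forall>i. \<bar>l $ i - real_of_int (z $ i)\<bar> < 2}"
      unfolding int_nbhd_def
    proof (intro subsetI, clarify)
      fix z i assume "\<forall>i. \<bar>x k $ i - real_of_int (z $ i)\<bar> < 1"
      then have "\<bar>x k $ i - real_of_int (z $ i)\<bar> < 1" by blast
      with \<open>\<And>i. \<bar>x k $ i - l $ i\<bar> < 1\<close>[of i] show "\<bar>l $ i - real_of_int (z $ i)\<bar> < 2" by linarith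
    qed
    moreover have "x k \<in> convex hull (emb ` (S \<inter> int_nbhd (x k)))"
      using assms x unfolding integrally_convex_set_def by blast
    ultimately show ?thesis
      using hull_mono[of "emb ` (S \<inter> int_nbhd (x k))" "emb ` ?T"] by blast
  qed
  ultimately have ev: "\<forall>\<^sub>F k in sequentially. x k \<in> convex hull (emb ` ?T)"
    by (rule eventually_mono)
  have "finite ?T" using finite_int_points_near by blast
  then have "closed (convex hull (emb ` ?T))"
    by (simp add: compact_imp_closed finite_imp_compact_convex_hull)
  then have "l \<in> convex hull (emb ` ?T)"
    using Lim_in_closed_set[OF _ ev _ lim] by simp
  then show "l \<in> convex hull (emb ` S)"
    using hull_mono[of "emb ` ?T" "emb ` S"] by blast
qed

text \<open>Recording steps relative to \<open>z\<close> makes all values subsets of one finite box,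
  so only finitely many arise as \<open>z\<close> varies.\<close>

definition local_steps :: "(int ^ 'n::finite) set \<Rightarrow> int ^ 'n \<Rightarrow> (int ^ 'n) set" where
  "local_steps S z = {v. (\<forall>i. \<bar>v $ i\<bar> \<le> 1) \<and> z + v \<in> S}"

definition local_cone :: "(int ^ 'n::finite) set \<Rightarrow> int ^ 'n \<Rightarrow> (real ^ 'n) set" where
  "local_cone S z = convex_cone hull (emb ` local_steps S z)"

lemma local_steps_subset: "local_steps S z \<subseteq> {v. \<forall>i. - 1 \<le> v $ i \<and> v $ i \<le> 1}"
proof clarify
  fix v i assume "v \<in> local_steps S z"
  then have "\<bar>v $ i\<bar> \<le> 1" by (simp add: local_steps_def)
  then show "- 1 \<le> v $ i \<and> v $ i \<le> 1" by linarith
qed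

lemma finite_local_steps: "finite (local_steps S z)"
  using finite_subset[OF local_steps_subset finite_int_box] .

lemma finite_range_local_steps: "finite (range (local_steps S))"
proof (rule finite_subset)
  show "range (local_steps S) \<subseteq> Pow {v. \<forall>i. - 1 \<le> v $ i \<and> v $ i \<le> 1}"
    using local_steps_subset by (intro image_subsetI PowI)
qed (simp only: finite_Pow_iff finite_int_box)

text \<open>A short move from \<open>z\<close> towards \<open>w\<close> gives a point
  \<open>x\<close> less than 1 from \<open>z\<close> in every coordinate. Integral convexity writes
  \<open>x\<close> by points of \<open>S\<close> near \<open>x\<close>; by integrality these differ
  from \<open>z\<close> by at most 1 in each coordinate, and the cone absorbs the rescaling.\<close>

lemma hull_minus_in_local_cone:
  assumes S: "integrally_convex_set S" and z: "z \<in> S" and w: "w \<in> convex hull (emb ` S)"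
  shows "w - emb z \<in> local_cone S z"
proof -
  define e where "e = inverse (1 + norm (w - emb z))"
  have e: "0 < e" "e \<le> 1" by (auto simp: e_def add_pos_nonneg intro: inverse_le_1_iff[THEN iffD2])
  define x where "x = emb z + e *\<^sub>R (w - emb z)"
  have "x = (1 - e) *\<^sub>R emb z + e *\<^sub>R w" by (simp add: x_def algebra_simps)
  also have "\<dots> \<in> convex hull (emb ` S)"
    using z w e by (intro convexD_alt) (auto simp: hull_inc)
  finally have "x \<in> convex hull (emb ` (S \<inter> int_nbhd x))"
    using S unfolding integrally_convex_set_def by blast
  moreover have "convex hull (emb ` (S \<inter> int_nbhd x)) \<subseteq> {y. y - emb z \<in> local_cone S z}"
  proof (rule hull_minimal)
    have small: "\<bar>x $ i - real_of_int (z $ i)\<bar> < 1" for i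
    proof -
      have "\<bar>x $ i - real_of_int (z $ i)\<bar> \<le> norm (x - emb z)"
        using component_le_norm_cart[of "x - emb z" i] by simp
      also have "\<dots> = norm (w - emb z) / (1 + norm (w - emb z))"
        using e by (simp add: x_def e_def divide_inverse_commute)
      also have "\<dots> < 1" by (simp add: divide_less_eq add_pos_nonneg)
      finally show ?thesis .
    qed
    show "emb ` (S \<inter> int_nbhd x) \<subseteq> {y. y - emb z \<in> local_cone S z}"
    proof clarify
      fix u assume u: "u \<in> S" "u \<in> int_nbhd x"
      have "\<bar>(u - z) $ i\<bar> \<le> 1" for i
      proof -
        have "\<bar>x $ i - real_of_int (u $ i)\<bar> < 1" using u(2) by (simp add: int_nbhd_def)
        then show ?thesis using small[of i] unfolding vector_minus_component by linarith
      qed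
      then have "u - z \<in> local_steps S z" using u(1) by (simp add: local_steps_def)
      then show "emb u - emb z \<in> local_cone S z"
        unfolding local_cone_def emb_diff[symmetric] by (intro hull_inc) blast
    qed
    show "convex {y. y - emb z \<in> local_cone S z}"
    proof -
      have "{y. y - emb z \<in> local_cone S z} = (+) (emb z) ` local_cone S z"
        by (force simp: image_iff)
      then show ?thesis
        by (simp add: local_cone_def convex_convex_cone_hull convex_translation)
    qed
  qed
  ultimately have "e *\<^sub>R (w - emb z) \<in> local_cone S z" by (auto simp: x_def)
  then have "inverse e *\<^sub>R (e *\<^sub>R (w - emb z)) \<in> local_cone S z"
    unfolding local_cone_def by (rule convex_cone_hull_mul) (use e in simp)
  then show ?thesis using e by simp
qed

text \<open>If \<open>x\<close> is outside the hull, let \<open>y\<close> be the nearest point of it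
  and \<open>q = x - y\<close>. The supporting hyperplane at \<open>y\<close> contains some
  \<open>z\<close> of \<open>S\<close>, and \<open>q\<close> is at most 0 on the local cone at
  \<open>z\<close>, whereas \<open>q \<bullet> (x - emb z)\<close> equals
  \<open>q \<bullet> q\<close>.\<close>

lemma mem_hull_iff_local_cones:
  assumes S: "integrally_convex_set S"
  shows "x \<in> convex hull (emb ` S) \<longleftrightarrow> (\<forall>z\<in>S. x - emb z \<in> local_cone S z)"
proof
  assume x: "\<forall>z\<in>S. x - emb z \<in> local_cone S z"
  let ?C = "convex hull (emb ` S)"
  show "x \<in> ?C"
  proof (rule ccontr)
    assume nx: "x \<notin> ?C"
    have clC: "closed ?C" by (rule closed_integrally_convex_hull[OF S])
    have neC: "?C \<noteq> {}" using S by (auto simp: integrally_convex_set_def)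
    define y where "y = closest_point ?C x"
    define q where "q = x - y"
    have yC: "y \<in> ?C" unfolding y_def by (rule closest_point_in_set[OF clC neC])
    have q: "q \<bullet> (s - y) \<le> 0" if "s \<in> ?C" for s
      unfolding q_def y_def by (rule closest_point_dot[OF convex_convex_hull clC that])
    have "y \<in> convex hull (emb ` (S \<inter> int_nbhd y))"
      using S yC unfolding integrally_convex_set_def by blast
    then have "y \<in> convex hull {s \<in> emb ` (S \<inter> int_nbhd y). (- q) \<bullet> s = (- q) \<bullet> y}"
      by (intro convex_hull_level_face)
        (use q in \<open>auto simp: inner_diff_right hull_inc\<close>)
    then have "{s \<in> emb ` (S \<inter> int_nbhd y). (- q) \<bullet> s = (- q) \<bullet> y} \<noteq> {}"
      using convex_hull_empty by (metis (no_types, lifting) empty_iff)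
    then obtain z where z: "z \<in> S" "q \<bullet> emb z = q \<bullet> y" by auto
    have "local_cone S z \<subseteq> {v. q \<bullet> v \<le> 0}"
      unfolding local_cone_def
    proof (rule hull_minimal)
      show "emb ` local_steps S z \<subseteq> {v. q \<bullet> v \<le> 0}"
      proof clarify
        fix v assume "v \<in> local_steps S z"
        then have "emb (z + v) \<in> ?C" by (auto simp: local_steps_def hull_inc)
        from q[OF this] show "q \<bullet> emb v \<le> 0"
          using z(2) by (simp add: emb_add inner_diff_right inner_add_right)
      qed
    qed (rule convex_cone_halfspace_le)
    then have "q \<bullet> (x - emb z) \<le> 0" using x z(1) by blast
    then have "q \<bullet> q \<le> 0" using z(2) by (simp add: q_def inner_diff_right)
    then have "q = 0" by (metis inner_eq_zero_iff inner_ge_zero order_antisym)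
    then show False using nx yC by (simp add: q_def)
  qed
qed (use hull_minus_in_local_cone[OF S] in blast)

lemma convex_cone_local_cone: "convex_cone (local_cone S z)"
  by (simp add: local_cone_def convex_cone_convex_cone_hull)

text \<open>Read off from the description of the hull by translated cones: a vector common to all
  cones may be added freely, and conversely \<open>emb z + d\<close> in the hull puts
  \<open>d\<close> into the cone at \<open>z\<close>.\<close>

lemma rec_cone_integrally_convex:
  assumes S: "integrally_convex_set S"
  shows "rec_cone (convex hull (emb ` S)) = (\<Inter>z\<in>S. local_cone S z)"
proof (intro equalityI subsetI)
  fix d assume d: "d \<in> rec_cone (convex hull (emb ` S))"
  have "d \<in> local_cone S z" if z: "z \<in> S" for z
  proof -
    have "emb z + 1 *\<^sub>R d \<in> convex hull (emb ` S)"
      using z by (intro rec_coneD[OF d]) (auto simp: hull_inc)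
    from hull_minus_in_local_cone[OF S z this] show ?thesis by simp
  qed
  then show "d \<in> (\<Inter>z\<in>S. local_cone S z)" by blast
next
  fix d assume d: "d \<in> (\<Inter>z\<in>S. local_cone S z)"
  show "d \<in> rec_cone (convex hull (emb ` S))"
    unfolding rec_cone_def
  proof clarify
    fix y and t :: real
    assume y: "y \<in> convex hull (emb ` S)" and t: "0 \<le> t"
    have "(y - emb z) + t *\<^sub>R d \<in> local_cone S z" if z: "z \<in> S" for z
      using hull_minus_in_local_cone[OF S z y] d z t convex_cone_local_cone
      by (simp add: convex_cone_add[OF convex_cone_local_cone] convex_cone_scaleR[OF convex_cone_local_cone])
    then show "y + t *\<^sub>R d \<in> convex hull (emb ` S)"
      unfolding mem_hull_iff_local_cones[OF S] by (simp add: algebra_simps)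
  qed
qed

text \<open>\<open>Z\<close> may be infinite. Each half-space of \<open>K\<close> yields a family of
  parallel half-spaces; a point \<open>x0\<close> of the intersection bounds their offsets, so an
  infimum replaces the family by one half-space.\<close>

lemma polyhedron_Inter_translations:
  fixes K :: "'a::euclidean_space set"
  assumes "polyhedron K"
  shows "polyhedron {x. \<forall>z\<in>Z. x - z \<in> K}"
proof (cases "{x. \<forall>z\<in>Z. x - z \<in> K} = {} \<or> Z = {}")
  case True
  then show ?thesis
  proof
    assume "Z = {}"
    then have "{x. \<forall>z\<in>Z. x - z \<in> K} = UNIV" by blast
    then show ?thesis by (simp only: polyhedron_UNIV)
  qed (simp only: polyhedron_empty)
next
  case False
  then obtain x0 where x0: "\<forall>z\<in>Z. x0 - z \<in> K" and Z: "Z \<noteq> {}" by blast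
  obtain A where A: "finite A" "K = {x. \<forall>(a,b)\<in>A. a \<bullet> x \<le> b}"
    using polyhedron_halfspaces[OF assms] by blast
  have "(\<forall>z\<in>Z. a \<bullet> (x - z) \<le> b) \<longleftrightarrow> a \<bullet> x \<le> b + (INF z\<in>Z. a \<bullet> z)" if ab: "(a, b) \<in> A" for a b x
  proof -
    have "bdd_below ((\<lambda>z. a \<bullet> z) ` Z)"
    proof (rule bdd_belowI2)
      fix z assume "z \<in> Z"
      then show "a \<bullet> x0 - b \<le> a \<bullet> z"
        using bspec[OF x0] ab unfolding A(2) by (fastforce simp: inner_diff_right)
    qed
    then have "a \<bullet> x - b \<le> (INF z\<in>Z. a \<bullet> z) \<longleftrightarrow> (\<forall>z\<in>Z. a \<bullet> x - b \<le> a \<bullet> z)"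
      using Z by (intro le_cINF_iff)
    then show ?thesis by (simp add: inner_diff_right diff_le_eq add.commute)
  qed
  then have "(\<forall>z\<in>Z. x - z \<in> K) \<longleftrightarrow> (\<forall>(a,b)\<in>A. a \<bullet> x \<le> b + (INF z\<in>Z. a \<bullet> z))" for x
    unfolding A(2) by blast
  then have "{x. \<forall>z\<in>Z. x - z \<in> K}
      = \<Inter>((\<lambda>(a,b). {x. a \<bullet> x \<le> b + (INF z\<in>Z. a \<bullet> z)}) ` A)"
    by auto
  moreover have "polyhedron \<dots>"
    using A(1) by (intro polyhedron_Inter) (auto intro: polyhedron_halfspace_le)
  ultimately show ?thesis by simp
qed

text \<open>Grouping the points of \<open>S\<close> by step set leaves a finite intersection, each
  member of which intersects translates of one finitely generated cone.\<close>

lemma polyhedron_integrally_convex_hull: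
  assumes S: "integrally_convex_set S"
  shows "polyhedron (convex hull (emb ` S))"
proof -
  define K where
    "K T = {x. \<forall>z\<in>emb ` {z\<in>S. local_steps S z = T}. x - z \<in> convex_cone hull (emb ` T)}" for T
  have "convex hull (emb ` S) = \<Inter>(K ` (local_steps S ` S))"
  proof (rule set_eqI)
    fix x
    have "x \<in> \<Inter>(K ` (local_steps S ` S)) \<longleftrightarrow> (\<forall>z\<in>S. x - emb z \<in> local_cone S z)"
      unfolding local_cone_def K_def by auto
    then show "x \<in> convex hull (emb ` S) \<longleftrightarrow> x \<in> \<Inter>(K ` (local_steps S ` S))"
      using mem_hull_iff_local_cones[OF S] by simp
  qed
  moreover have "polyhedron \<dots>"
  proof (rule polyhedron_Inter)
    show "finite (K ` (local_steps S ` S))" by (rule finite_imageI[OF finite_subset[OF image_mono[OF subset_UNIV] finite_range_local_steps]])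
    show "polyhedron X" if X: "X \<in> K ` (local_steps S ` S)" for X
    proof -
      obtain z where "X = K (local_steps S z)" using X by blast
      then show ?thesis
        unfolding K_def by (simp only:) (intro polyhedron_Inter_translations polyhedron_convex_cone_hull finite_imageI
            finite_local_steps)
    qed
  qed
  ultimately show ?thesis by simp
qed

section \<open>Integer generators of the recession cone\<close>

text \<open>A functional minimal on the face forces the local representation of \<open>x\<close> to
  use points of the face only. These faces drive the induction on dimension below.\<close>

lemma integrally_convex_set_face:
  assumes S: "integrally_convex_set S" and "z \<in> S" and a: "\<And>s. s \<in> S \<Longrightarrow> a \<bullet> emb z \<le> a \<bullet> emb s"
  shows "integrally_convex_set {s \<in> S. a \<bullet> emb s = a \<bullet> emb z}" (is "integrally_convex_set ?S'")
  unfolding integrally_convex_set_def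
proof (intro conjI ballI)
  show "?S' \<noteq> {}" using \<open>z \<in> S\<close> by blast
next
  fix x assume x: "x \<in> convex hull (emb ` ?S')"
  have "convex hull (emb ` ?S') \<subseteq> {x. a \<bullet> x = a \<bullet> emb z}"
    by (rule hull_minimal) (auto simp: convex_hyperplane)
  then have ax: "a \<bullet> x = a \<bullet> emb z" using x by blast
  have "x \<in> convex hull (emb ` S)"
    using x hull_mono[of "emb ` ?S'" "emb ` S"] by blast
  then have "x \<in> convex hull (emb ` (S \<inter> int_nbhd x))"
    using S unfolding integrally_convex_set_def by blast
  then have "x \<in> convex hull {y \<in> emb ` (S \<inter> int_nbhd x). a \<bullet> y = a \<bullet> emb z}"
    by (intro convex_hull_level_face) (use a ax in auto)
  moreover have "{y \<in> emb ` (S \<inter> int_nbhd x). a \<bullet> y = a \<bullet> emb z} = emb ` (?S' \<inter> int_nbhd x)"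
    by auto
  ultimately show "x \<in> convex hull (emb ` (?S' \<inter> int_nbhd x))" by simp
qed

lemma hull_subset_span:
  fixes z :: "'a::real_vector"
  assumes "x \<in> convex hull X" "z \<in> X"
  shows "x - z \<in> span ((\<lambda>y. y - z) ` X)"
proof -
  let ?L = "span ((\<lambda>y. y - z) ` X)"
  have "convex hull X \<subseteq> (+) z ` ?L"
  proof (rule hull_minimal)
    show "X \<subseteq> (+) z ` ?L"
      by (force simp: image_iff intro: span_base)
    show "convex ((+) z ` ?L)"
      by (rule convex_translation) (simp add: subspace_imp_convex)
  qed
  then show ?thesis using assms by auto
qed

text \<open>Every multiple \<open>N d\<close> is within a fixed distance of integer points of
  \<open>span W\<close>. Divided by \<open>N\<close> that distance falls below \<open>e\<close>, so
  for large \<open>N\<close> these points lie in the cone \<open>K\<close>.\<close>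

lemma integer_generators_of_interior_direction:
  fixes d :: "real ^ 'n::finite"
  assumes K: "convex_cone K" and W: "W \<subseteq> range emb" and d: "d \<in> span W"
    and "0 < e" and ball: "ball d e \<inter> span W \<subseteq> K"
  shows "d \<in> convex_cone hull (K \<inter> range emb)"
proof -
  obtain F c where F: "finite F" "F \<subseteq> W" and dF: "d = (\<Sum>w\<in>F. c w *\<^sub>R w)"
    using d unfolding span_explicit by blast
  show ?thesis
  proof (cases "F = {}")
    case True
    then show ?thesis using dF by (simp add: convex_cone_hull_contains_0)
  next
    case False
    define m where "m = card F"
    have m: "0 < m" using False F(1) by (simp add: m_def card_gt_0_iff)
    define M where "M = (\<Sum>w\<in>F. norm w)"
    have wM: "norm w \<le> M" if "w \<in> F" for w
      unfolding M_def using F(1) that by (intro member_le_sum) auto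
    have M0: "0 \<le> M" unfolding M_def by (intro sum_nonneg) auto
    obtain N0 :: nat where "(M + m * M) / e < real N0" using reals_Archimedean2 by blast
    define N where "N = Suc N0"
    have N: "0 < N" "(M + m * M) / e < N"
      using \<open>(M + m * M) / e < real N0\<close> by (auto simp: N_def)
    \<comment> \<open>\<open>N d\<close> is in the hull of the integer points \<open>u\<close> and \<open>u + m w\<close>, whose multiples by \<open>1/N\<close> are close to \<open>d\<close>.\<close>
    define u where "u = (\<Sum>w\<in>F. real_of_int \<lfloor>N * c w\<rfloor> *\<^sub>R w)"
    have Nd: "N *\<^sub>R d = u + (\<Sum>w\<in>F. frac (N * c w) *\<^sub>R w)"
      by (simp add: u_def dF scaleR_sum_right sum.distrib[symmetric] frac_def algebra_simps)
    have "norm (\<Sum>w\<in>F. frac (N * c w) *\<^sub>R w) \<le> M"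
      unfolding M_def
    proof (rule sum_norm_le)
      show "norm (frac (N * c w) *\<^sub>R w) \<le> norm w" for w
        using frac_lt_1[of "N * c w"] frac_ge_0[of "N * c w"]
        by (simp add: mult_left_le_one_le)
    qed
    then have Ndu: "norm (N *\<^sub>R d - u) \<le> M" by (simp add: Nd)
    have WE: "w \<in> range emb" if "w \<in> F" for w using that F(2) W by blast
    have WL: "w \<in> span W" if "w \<in> F" for w using that F(2) by (meson span_base subsetD)
    have uE: "u \<in> range emb"
      unfolding u_def by (intro sum_in_range_emb scaleR_of_int_in_range_emb WE)
    have uL: "u \<in> span W"
      unfolding u_def by (intro span_sum span_scale WL)
    have near: "p \<in> convex_cone hull (K \<inter> range emb)"
      if p: "p \<in> range emb" "p \<in> span W" "norm (N *\<^sub>R d - p) \<le> M + m * M" for p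
    proof -
      have "norm (d - p /\<^sub>R N) = norm (N *\<^sub>R d - p) / N"
      proof -
        have "d - p /\<^sub>R N = (N *\<^sub>R d - p) /\<^sub>R N" using N by (simp add: algebra_simps)
        then show ?thesis using N by (simp add: divide_inverse_commute)
      qed
      also have "\<dots> \<le> (M + m * M) / N" using p(3) N by (simp add: divide_right_mono)
      also have "\<dots> < e" using N \<open>0 < e\<close> by (simp add: field_simps)
      finally have "p /\<^sub>R N \<in> ball d e" by (simp add: dist_norm)
      then have "p /\<^sub>R N \<in> K" using ball p(2) by (auto intro: span_scale)
      then have "N *\<^sub>R (p /\<^sub>R N) \<in> K" by (rule convex_cone_scaleR[OF K, rotated]) simp
      then have "p \<in> K" using N by simp
      then show ?thesis using p(1) by (intro hull_inc) blast
    qed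
    have uH: "u \<in> convex_cone hull (K \<inter> range emb)"
      using uE uL Ndu M0 by (intro near) (auto intro: order_trans)
    have pH: "u + m *\<^sub>R w \<in> convex_cone hull (K \<inter> range emb)" if w: "w \<in> F" for w
    proof (rule near)
      show "u + m *\<^sub>R w \<in> range emb"
        using uE scaleR_of_int_in_range_emb[OF WE[OF w], of "int m"] add_in_range_emb by auto
      show "u + m *\<^sub>R w \<in> span W" using uL WL[OF w] by (intro span_add span_scale)
      have "norm (N *\<^sub>R d - (u + m *\<^sub>R w)) \<le> norm (N *\<^sub>R d - u) + norm (m *\<^sub>R w)"
        by (metis diff_diff_eq norm_triangle_ineq4)
      also have "\<dots> \<le> M + m * M"
        using Ndu wM[OF w] by (intro add_mono) (auto simp: mult_left_mono)
      finally show "norm (N *\<^sub>R d - (u + m *\<^sub>R w)) \<le> M + m * M" .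
    qed
    \<comment> \<open>The \<open>m\<close> terms \<open>h w\<close> contain \<open>u\<close>
      altogether \<open>m\<close> times, so the fractional parts need the factor \<open>m\<close>
      too for the sum to be \<open>m N d\<close>; hence the points \<open>u + m w\<close>.\<close>
    define h where "h w = (1 - frac (N * c w)) *\<^sub>R u + frac (N * c w) *\<^sub>R (u + m *\<^sub>R w)" for w
    have "h w \<in> convex_cone hull (K \<inter> range emb)" if w: "w \<in> F" for w
      unfolding h_def using frac_lt_1[of "N * c w"] frac_ge_0[of "N * c w"]
      by (intro convex_cone_hull_add[OF convex_cone_hull_mul[OF uH] convex_cone_hull_mul[OF pH[OF w]]]) auto
    then have "(\<Sum>w\<in>F. h w) \<in> convex_cone hull (K \<inter> range emb)"
      using F(1) by (intro convex_cone_sum[OF convex_cone_convex_cone_hull])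
    moreover have "(\<Sum>w\<in>F. h w) = (m * N) *\<^sub>R d"
    proof -
      have "h w = u + m *\<^sub>R (frac (N * c w) *\<^sub>R w)" for w
        by (simp add: h_def algebra_simps)
      then have "(\<Sum>w\<in>F. h w) = m *\<^sub>R u + m *\<^sub>R (\<Sum>w\<in>F. frac (N * c w) *\<^sub>R w)"
        by (simp add: sum.distrib scaleR_sum_right m_def sum_constant_scaleR del: sum_constant)
      also have "\<dots> = m *\<^sub>R (N *\<^sub>R d)" unfolding Nd by (simp add: scaleR_add_right)
      finally show ?thesis by simp
    qed
    ultimately have "(m * N) *\<^sub>R d \<in> convex_cone hull (K \<inter> range emb)" by simp
    from convex_cone_hull_mul[OF this, of "inverse (m * N)"] show ?thesis
      using m N by (simp add: field_simps)
  qed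
qed

lemma rec_cone_integer_generated:
  assumes "integrally_convex_set S" "d \<in> rec_cone (convex hull (emb ` S))"
  shows "d \<in> convex_cone hull (rec_cone (convex hull (emb ` S)) \<inter> range emb)"
  using assms
\<comment> \<open>\<open>aff_dim\<close> is -1 on the empty set; the shift by 1 makes the measure
  faithful under \<open>nat\<close>.\<close>
proof (induction "nat (aff_dim (emb ` S) + 1)" arbitrary: S rule: less_induct)
  case (less S)
  note S = less.prems(1)
  let ?C = "convex hull (emb ` S)"
  have dK: "d \<in> local_cone S z" if "z \<in> S" for z
    using less.prems rec_cone_integrally_convex[OF S] that by blast
  show ?case
  proof (cases "\<forall>z\<in>S. d \<in> rel_interior (local_cone S z)")
    case False
    \<comment> \<open>A functional supporting the local cone at \<open>d\<close> cuts out a face of smaller dimension that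
      still has \<open>d\<close> as a recession direction.\<close>
    then obtain z where z: "z \<in> S" and nd: "d \<notin> rel_interior (local_cone S z)" by blast
    have convK: "convex (local_cone S z)" using convex_cone_local_cone[of S z] by (simp add: convex_cone_def)
    obtain a where ge: "\<And>y. y \<in> local_cone S z \<Longrightarrow> a \<bullet> d \<le> a \<bullet> y"
      and gt: "\<And>y. y \<in> rel_interior (local_cone S z) \<Longrightarrow> a \<bullet> d < a \<bullet> y"
      using supporting_hyperplane_rel_boundary[OF convK dK[OF z] nd] by metis
    have "0 \<in> local_cone S z" using convex_cone_local_cone by (rule convex_cone_contains_0)
    moreover have "2 *\<^sub>R d \<in> local_cone S z"
      using dK[OF z] by (intro convex_cone_scaleR[OF convex_cone_local_cone]) auto
    \<comment> \<open>A linear functional that is minimal over a cone at \<open>d\<close> vanishes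
      there: comparison with \<open>0\<close> and \<open>2 d\<close> gives both
      inequalities.\<close>
    ultimately have ad: "a \<bullet> d = 0" using ge[of 0] ge[of "2 *\<^sub>R d"] by simp
    let ?S' = "{s \<in> S. a \<bullet> emb s = a \<bullet> emb z}"
    let ?C' = "convex hull (emb ` ?S')"
    have aS: "a \<bullet> emb z \<le> a \<bullet> emb s" if "s \<in> S" for s
      using ge[OF hull_minus_in_local_cone[OF S z]] that ad by (simp add: hull_inc inner_diff_right)
    have S': "integrally_convex_set ?S'"
      by (rule integrally_convex_set_face[OF S z aS])
    have zC': "emb z \<in> ?C'" using z by (simp add: hull_inc)
    have C'C: "?C' \<subseteq> ?C" by (intro hull_mono) auto
    \<comment> \<open>The face is proper: otherwise \<open>a\<close> would be at most 0 on the local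
      cone, against its positivity on the nonempty relative interior.\<close>
    have "\<exists>s\<in>S. a \<bullet> emb s > a \<bullet> emb z"
    proof (rule ccontr)
      assume "\<not> ?thesis"
      then have "local_cone S z \<subseteq> {v. a \<bullet> v \<le> 0}"
        unfolding local_cone_def
        by (intro hull_minimal convex_cone_halfspace_le)
          (force simp: local_steps_def emb_add inner_add_right)
      moreover have "rel_interior (local_cone S z) \<noteq> {}"
        using convK dK[OF z] rel_interior_eq_empty by blast
      ultimately show False using gt rel_interior_subset[of "local_cone S z"] ad by fastforce
    qed
    then obtain s where s: "s \<in> S" "a \<bullet> emb s > a \<bullet> emb z" by blast
    have "aff_dim (emb ` ?S') < aff_dim (emb ` S)"
    proof (rule aff_dim_psubset)
      have "affine hull (emb ` ?S') \<subseteq> {x. a \<bullet> x = a \<bullet> emb z}"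
        by (rule hull_minimal) (auto simp: affine_hyperplane)
      then have "emb s \<notin> affine hull (emb ` ?S')" using s(2) by auto
      moreover have "emb s \<in> affine hull (emb ` S)" using s(1) by (simp add: hull_inc)
      moreover have "affine hull (emb ` ?S') \<subseteq> affine hull (emb ` S)" by (intro hull_mono) auto
      ultimately show "affine hull (emb ` ?S') \<subset> affine hull (emb ` S)" by blast
    qed
    then have smaller: "nat (aff_dim (emb ` ?S') + 1) < nat (aff_dim (emb ` S) + 1)"
      using aff_dim_geq[of "emb ` ?S'"] by linarith
    have "d \<in> rec_cone ?C'"
    proof (rule rec_cone_if_ray[OF closed_integrally_convex_hull[OF S'] convex_convex_hull zC'])
      fix N :: nat
      have "emb z + real N *\<^sub>R d \<in> ?C"
        using z by (intro rec_coneD[OF less.prems(2)]) (auto simp: hull_inc)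
      then have "emb z + real N *\<^sub>R d \<in> convex hull {y \<in> emb ` S. a \<bullet> y = a \<bullet> emb z}"
        by (intro convex_hull_level_face) (use aS ad in \<open>auto simp: inner_add_right\<close>)
      moreover have "{y \<in> emb ` S. a \<bullet> y = a \<bullet> emb z} = emb ` ?S'" by auto
      ultimately show "emb z + real N *\<^sub>R d \<in> ?C'" by simp
    qed
    from less.hyps[OF smaller S' this]
    have "d \<in> convex_cone hull (rec_cone ?C' \<inter> range emb)" .
    moreover have "rec_cone ?C' \<subseteq> rec_cone ?C"
    proof
      fix w assume w: "w \<in> rec_cone ?C'"
      show "w \<in> rec_cone ?C"
      proof (rule rec_cone_if_ray[OF closed_integrally_convex_hull[OF S] convex_convex_hull
            subsetD[OF C'C zC']])
        show "emb z + real N *\<^sub>R w \<in> ?C" for N :: nat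
          using rec_coneD[OF w zC', of "real N"] C'C by auto
      qed
    qed
    ultimately show ?thesis
      using hull_mono[of "rec_cone ?C' \<inter> range emb" "rec_cone ?C \<inter> range emb"] by blast
  next
    case True
    obtain z0 where z0: "z0 \<in> S" using S by (auto simp: integrally_convex_set_def)
    let ?W = "(\<lambda>y. y - emb z0) ` emb ` S"
    have W: "?W \<subseteq> range emb" by (auto simp: emb_diff[symmetric])
    have "emb z0 + 1 *\<^sub>R d \<in> ?C"
      using z0 by (intro rec_coneD[OF less.prems(2)]) (auto simp: hull_inc)
    then have dW: "d \<in> span ?W"
      using hull_subset_span[of "emb z0 + d" "emb ` S" "emb z0"] z0 by simp
    \<comment> \<open>A cone contains \<open>0\<close>, so its affine hull is its span, which
      contains all differences of points of \<open>S\<close>. Relative balls around \<open>d\<close>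
      in the various cones thus all cover balls in \<open>span ?W\<close>.\<close>
    have WK: "span ?W \<subseteq> affine hull (local_cone S z)" if z: "z \<in> S" for z
    proof -
      have "y - emb z0 \<in> span (local_cone S z)" if y: "y \<in> emb ` S" for y
      proof -
        have "y - emb z \<in> local_cone S z" "emb z0 - emb z \<in> local_cone S z"
          using hull_minus_in_local_cone[OF S z] y z0 by (auto simp: hull_inc)
        then have "(y - emb z) - (emb z0 - emb z) \<in> span (local_cone S z)"
          by (intro span_diff span_base)
        then show ?thesis by simp
      qed
      then have "span ?W \<subseteq> span (local_cone S z)" by (intro span_minimal) auto
      moreover have "0 \<in> affine hull (local_cone S z)"
        using convex_cone_contains_0[OF convex_cone_local_cone] by (rule hull_inc)
      ultimately show ?thesis using affine_hull_span_0 by metis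
    qed
    let ?F = "local_cone S ` S"
    have finF: "finite ?F"
    proof -
      have "?F \<subseteq> (\<lambda>T. convex_cone hull (emb ` T)) ` range (local_steps S)"
        by (auto simp: local_cone_def)
      then show ?thesis using finite_range_local_steps finite_subset by blast
    qed
    have "\<forall>K\<in>?F. \<exists>e>0. ball d e \<inter> affine hull K \<subseteq> K"
      using True by (auto simp: mem_rel_interior_ball)
    then obtain r where r: "\<And>K. K \<in> ?F \<Longrightarrow> 0 < r K \<and> ball d (r K) \<inter> affine hull K \<subseteq> K"
      by metis
    \<comment> \<open>Only finitely many cones occur although \<open>S\<close> may be infinite, so
      the smallest of the radii is positive.\<close>
    define e where "e = Min (r ` ?F)"
    have e: "0 < e" unfolding e_def using finF z0 r by (subst Min_gr_iff) auto
    have "ball d e \<inter> span ?W \<subseteq> rec_cone ?C"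
      unfolding rec_cone_integrally_convex[OF S]
    proof (intro subsetI INT_I)
      fix x z assume x: "x \<in> ball d e \<inter> span ?W" and z: "z \<in> S"
      have "e \<le> r (local_cone S z)" unfolding e_def using finF z by (intro Min_le) auto
      then show "x \<in> local_cone S z"
        using x z WK[OF z] r[of "local_cone S z"] by auto
    qed
    from integer_generators_of_interior_direction[OF convex_cone_rec_cone W dW e this]
    show ?thesis .
  qed
qed

text \<open>The cones generated by the finite subsets of \<open>X\<close> form a directed union,
  which is itself a convex cone containing \<open>X\<close>.\<close>

lemma convex_cone_hull_finite_subset:
  assumes "x \<in> convex_cone hull X"
  obtains F where "finite F" "F \<subseteq> X" "x \<in> convex_cone hull F"
proof -
  let ?U = "\<Union>F\<in>{F. finite F \<and> F \<subseteq> X}. convex_cone hull F"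
  have "convex_cone hull X \<subseteq> ?U"
  proof (rule hull_minimal)
    show "X \<subseteq> ?U"
    proof
      fix y assume "y \<in> X"
      then show "y \<in> ?U" by (intro UN_I[of "{y}"]) (auto intro: hull_inc)
    qed
    show "convex_cone ?U"
    proof (rule convex_cone_iff[THEN iffD2], intro conjI ballI allI impI)
      show "0 \<in> ?U" by (intro UN_I[of "{}"]) auto
    next
      fix x y assume "x \<in> ?U" "y \<in> ?U"
      then obtain F G where FG: "finite F" "F \<subseteq> X" "x \<in> convex_cone hull F"
        "finite G" "G \<subseteq> X" "y \<in> convex_cone hull G" by blast
      then have "x + y \<in> convex_cone hull (F \<union> G)"
        unfolding convex_cone_hull_Un by blast
      then show "x + y \<in> ?U" using FG by (intro UN_I[of "F \<union> G"]) auto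
    next
      fix x and c :: real assume "x \<in> ?U" "0 \<le> c"
      then show "c *\<^sub>R x \<in> ?U" by (auto intro: convex_cone_hull_mul)
    qed
  qed
  then show ?thesis using assms that by blast
qed

text \<open>Each of the finitely many recession generators of the polyhedron is replaced by finitely
  many integer recession directions that produce it. The points of \<open>B\<close> need not be
  integer.\<close>

lemma integrally_convex_hull_decomposition:
  assumes S: "integrally_convex_set S"
  obtains B W where "finite B" "B \<subseteq> convex hull (emb ` S)"
    "finite W" "emb ` W \<subseteq> rec_cone (convex hull (emb ` S))"
    "\<And>x. x \<in> convex hull (emb ` S) \<Longrightarrow>
       \<exists>b\<in>convex hull B. \<exists>r\<in>convex_cone hull (emb ` W). x = b + r"
proof -
  let ?C = "convex hull (emb ` S)"
  have "?C \<noteq> {}" using S by (auto simp: integrally_convex_set_def)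
  then obtain B R where B: "finite B" "B \<subseteq> ?C" and R: "finite R" "R \<subseteq> rec_cone ?C"
    and dec: "\<And>x. x \<in> ?C \<Longrightarrow> \<exists>b\<in>convex hull B. \<exists>r\<in>convex_cone hull R. x = b + r"
    using polyhedron_decomposition[OF polyhedron_integrally_convex_hull[OF S]] by metis
  have "\<exists>G. finite G \<and> G \<subseteq> rec_cone ?C \<inter> range emb \<and> r \<in> convex_cone hull G" if "r \<in> R" for r
    using convex_cone_hull_finite_subset[OF rec_cone_integer_generated[OF S subsetD[OF R(2) that]]]
    by metis
  then obtain G where G: "\<And>r. r \<in> R \<Longrightarrow> finite (G r) \<and> G r \<subseteq> rec_cone ?C \<inter> range emb \<and> r \<in> convex_cone hull (G r)"
    by metis
  have "finite (\<Union>r\<in>R. G r)" "(\<Union>r\<in>R. G r) \<subseteq> range emb" using G R(1) by auto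
  then obtain W where W: "finite W" "(\<Union>r\<in>R. G r) = emb ` W"
    using finite_subset_image[of "\<Union>r\<in>R. G r" emb UNIV] by auto
  have "convex_cone hull R \<subseteq> convex_cone hull (emb ` W)"
  proof (rule hull_minimal)
    show "convex_cone (convex_cone hull (emb ` W))" by (rule convex_cone_convex_cone_hull)
    show "R \<subseteq> convex_cone hull (emb ` W)"
    proof
      fix r assume "r \<in> R"
      then have "r \<in> convex_cone hull (G r)" "G r \<subseteq> emb ` W" using G W(2) by auto
      then show "r \<in> convex_cone hull (emb ` W)"
        using hull_mono[of "G r" "emb ` W" convex_cone] by blast
    qed
  qed
  moreover have "emb ` W \<subseteq> rec_cone ?C" using G unfolding W(2)[symmetric] by blast
  ultimately show ?thesis using that[OF B W(1)] dec by (meson subsetD)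
qed

section \<open>Affine minorants and contact sets\<close>

definition contact_set :: "(int ^ 'n::finite \<Rightarrow> ereal) \<Rightarrow> real ^ 'n \<Rightarrow> real \<Rightarrow> (int ^ 'n) set" where
  "contact_set f p \<alpha> = {z. f z = ereal (p \<bullet> emb z + \<alpha>)}"

lemma tilt_ge_iff: "ereal \<alpha> \<le> tilt f p z \<longleftrightarrow> ereal (p \<bullet> emb z + \<alpha>) \<le> f z"
  unfolding tilt_def by (cases "f z") auto

lemma tilt_eq_iff: "tilt f p z = ereal \<alpha> \<longleftrightarrow> f z = ereal (p \<bullet> emb z + \<alpha>)"
  unfolding tilt_def by (cases "f z") auto

lemma argmin_tilt_eq_contact_set:
  assumes "affine_minorant f p \<alpha>" "contact_set f p \<alpha> \<noteq> {}"
  shows "argmin_set (tilt f p) = contact_set f p \<alpha>" "attains_finite_min (tilt f p)"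
proof -
  have ge: "ereal \<alpha> \<le> tilt f p z" for z
    using assms(1) by (simp add: tilt_ge_iff affine_minorant_def)
  obtain z0 where z0: "tilt f p z0 = ereal \<alpha>"
    using assms(2) by (auto simp: contact_set_def tilt_eq_iff)
  show eq: "argmin_set (tilt f p) = contact_set f p \<alpha>"
    unfolding argmin_set_def contact_set_def tilt_eq_iff[symmetric]
    using ge z0 by (auto intro: antisym) (metis order_antisym)
  show "attains_finite_min (tilt f p)"
    unfolding attains_finite_min_def eq
    using z0 by (intro bexI[of _ z0]) (auto simp: contact_set_def tilt_eq_iff[symmetric])
qed

lemma attains_finite_min_contact_set:
  assumes "attains_finite_min (tilt f p)"
  obtains \<alpha> where "affine_minorant f p \<alpha>" "argmin_set (tilt f p) = contact_set f p \<alpha>"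
    "contact_set f p \<alpha> \<noteq> {}"
proof -
  obtain z where z: "z \<in> argmin_set (tilt f p)" "\<bar>tilt f p z\<bar> \<noteq> \<infinity>"
    using assms by (auto simp: attains_finite_min_def)
  then obtain \<alpha> where \<alpha>: "tilt f p z = ereal \<alpha>" by auto
  have "affine_minorant f p \<alpha>"
    using z(1) \<alpha> by (auto simp: affine_minorant_def argmin_set_def tilt_ge_iff[symmetric])
  moreover have "z \<in> contact_set f p \<alpha>" using \<alpha> by (simp add: contact_set_def tilt_eq_iff)
  ultimately show ?thesis using that argmin_tilt_eq_contact_set by blast
qed

text \<open>With \<open>\<alpha>\<close> the minimum value of \<open>tilt f p\<close>, minimisers
  are exactly the points where the affine minorant is tight.\<close>

lemma integrally_convex_argmin_iff:
  "(\<forall>p. attains_finite_min (tilt f p) \<longrightarrow> integrally_convex_set (argmin_set (tilt f p))) \<longleftrightarrow>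
   (\<forall>p \<alpha>. affine_minorant f p \<alpha> \<longrightarrow> contact_set f p \<alpha> \<noteq> {} \<longrightarrow>
      integrally_convex_set (contact_set f p \<alpha>))"
  using argmin_tilt_eq_contact_set attains_finite_min_contact_set by metis

text \<open>The epigraph of an affine function with its boundary kept only over \<open>X\<close>. A
  boundary point shown to lie in it must be over \<open>X\<close>, which is how points are located
  in hulls of contact sets.\<close>

definition graph_or_above :: "'a::real_inner \<Rightarrow> real \<Rightarrow> 'a set \<Rightarrow> ('a \<times> real) set" where
  "graph_or_above p \<alpha> X =
     {y. snd y - (p \<bullet> fst y + \<alpha>) > 0} \<union> {y. fst y \<in> X \<and> snd y = p \<bullet> fst y + \<alpha>}"

lemma convex_graph_or_above:
  assumes "convex X" shows "convex (graph_or_above p \<alpha> X)"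
  unfolding graph_or_above_def
proof (rule convex_strict_side_Un)
  show "convex {y. fst y \<in> X \<and> snd y = p \<bullet> fst y + \<alpha>}"
    using assms by (auto simp: convex_alt inner_simps algebra_simps)
qed (auto simp: inner_simps algebra_simps)

text \<open>A direction steeper than the slope \<open>p \<bullet> w\<close> leaves the boundary at
  once; one of exactly that slope runs along it and so has to preserve \<open>X\<close>.\<close>

lemma graph_or_above_rec_cone:
  assumes "p \<bullet> w \<le> \<tau>" and "p \<bullet> w = \<tau> \<Longrightarrow> w \<in> rec_cone X"
  shows "(w, \<tau>) \<in> rec_cone (graph_or_above p \<alpha> X)"
  unfolding rec_cone_def
proof clarify
  fix x t and s :: real
  assume y: "(x, t) \<in> graph_or_above p \<alpha> X" and s: "0 \<le> s"
  have le: "s * (p \<bullet> w) \<le> s * \<tau>" using assms(1) s by (rule mult_left_mono)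
  have ge: "p \<bullet> x + \<alpha> \<le> t" using y by (auto simp: graph_or_above_def)
  consider "s = 0" | "p \<bullet> w = \<tau>" | "s * (p \<bullet> w) < s * \<tau>" using assms(1) s by fastforce
  then show "(x, t) + s *\<^sub>R (w, \<tau>) \<in> graph_or_above p \<alpha> X"
  proof cases
    case 1 then show ?thesis using y by simp
  next
    case 2
    then show ?thesis using y s rec_coneD[OF assms(2)[OF 2], of x s]
      by (auto simp: graph_or_above_def inner_simps)
  next
    case 3 then show ?thesis using ge by (auto simp: graph_or_above_def inner_simps)
  qed
qed

lemma closed_convex_hull_plus_cone:
  fixes B :: "'a::euclidean_space set"
  assumes "finite B" "finite W"
  shows "closed {b + w | b w. b \<in> convex hull B \<and> w \<in> convex_cone hull W}"
    and "convex {b + w | b w. b \<in> convex hull B \<and> w \<in> convex_cone hull W}"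
proof -
  have eq: "{b + w | b w. b \<in> convex hull B \<and> w \<in> convex_cone hull W}
      = (\<Union>b\<in>convex hull B. \<Union>w\<in>convex_cone hull W. {b + w})" by blast
  show "closed {b + w | b w. b \<in> convex hull B \<and> w \<in> convex_cone hull W}"
    unfolding eq using assms
    by (intro compact_closed_sums finite_imp_compact_convex_hull closed_convex_cone_hull)
  show "convex {b + w | b w. b \<in> convex hull B \<and> w \<in> convex_cone hull W}"
    unfolding eq by (intro convex_sums convex_convex_hull convex_convex_cone_hull)
qed

lemma rec_cone_convex_hull_plus_cone:
  assumes "w \<in> W"
  shows "w \<in> rec_cone {b + w | b w. b \<in> convex hull B \<and> w \<in> convex_cone hull W}"
  unfolding rec_cone_def
proof clarify
  fix b v and t :: real assume bv: "b \<in> convex hull B" "v \<in> convex_cone hull W" and t: "0 \<le> t"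
  have "v + t *\<^sub>R w \<in> convex_cone hull W"
    using convex_cone_hull_add[OF bv(2) convex_cone_hull_mul[OF hull_inc[of w W] t]] assms by blast
  then show "\<exists>b' w'. b + v + t *\<^sub>R w = b' + w' \<and> b' \<in> convex hull B \<and> w' \<in> convex_cone hull W"
    using bv by (metis add.assoc)
qed

text \<open>Constraints on the epigraph with \<open>b < 0\<close> bound the height from below and
  give the affine pieces; the others survive any decrease of the height. If no piece were tight at a
  finite value, that value could be lowered.\<close>

lemma polyhedral_max_affine:
  fixes g :: "real ^ 'n::finite \<Rightarrow> ereal"
  assumes "polyhedral_convex_fun g" and nm: "\<And>x. g x \<noteq> -\<infinity>"
  obtains A where "finite A" "\<And>p \<alpha> x. (p, \<alpha>) \<in> A \<Longrightarrow> ereal (p \<bullet> x + \<alpha>) \<le> g x"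
    "\<And>x. g x \<noteq> \<infinity> \<Longrightarrow> \<exists>(p, \<alpha>)\<in>A. g x = ereal (p \<bullet> x + \<alpha>)"
proof -
  obtain H where H: "finite H" "epigraph g = {y. \<forall>(a, \<beta>)\<in>H. a \<bullet> y \<le> \<beta>}"
    using polyhedron_halfspaces assms(1) unfolding polyhedral_convex_fun_def by blast
  have E: "g x \<le> ereal t \<longleftrightarrow> (\<forall>((a, b), \<beta>)\<in>H. a \<bullet> x + b * t \<le> \<beta>)" for x t
  proof -
    have "g x \<le> ereal t \<longleftrightarrow> (x, t) \<in> epigraph g" by (simp add: epigraph_def)
    also have "\<dots> \<longleftrightarrow> (\<forall>((a, b), \<beta>)\<in>H. a \<bullet> x + b * t \<le> \<beta>)"
      unfolding H(2) by (auto simp: inner_prod_def)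
    finally show ?thesis .
  qed
  define A where "A = (\<lambda>((a, b), \<beta>). (- (a /\<^sub>R b), \<beta> / b)) ` {((a, b), \<beta>) \<in> H. b < 0}"
  have conv: "a \<bullet> x + b * t \<le> \<beta> \<longleftrightarrow> - (a /\<^sub>R b) \<bullet> x + \<beta> / b \<le> t" if "b < 0" for a x b t \<beta>
    using that by (auto simp: field_simps)
  have finA: "finite A" unfolding A_def using H(1) by (auto intro!: finite_imageI elim: finite_subset[rotated])
  show ?thesis
  proof (rule that[OF finA])
    fix p \<alpha> x assume "(p, \<alpha>) \<in> A"
    then obtain a b \<beta> where h: "((a, b), \<beta>) \<in> H" "b < 0" "p = - (a /\<^sub>R b)" "\<alpha> = \<beta> / b"
      by (auto simp: A_def)
    show "ereal (p \<bullet> x + \<alpha>) \<le> g x"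
    proof (cases "g x")
      case (real r)
      then have "a \<bullet> x + b * r \<le> \<beta>" using E[of x r] h(1) by auto
      then show ?thesis using conv[OF h(2), of a x r \<beta>] real unfolding h(3,4) by simp
    qed (use nm in auto)
  next
    fix x assume "g x \<noteq> \<infinity>"
    then obtain r where r: "g x = ereal r" using nm by (cases "g x") auto
    have low: "r \<le> s" if "s \<le> r" and s: "\<And>p \<alpha>. (p, \<alpha>) \<in> A \<Longrightarrow> p \<bullet> x + \<alpha> \<le> s" for s
    proof -
      have "a \<bullet> x + b * s \<le> \<beta>" if h: "((a, b), \<beta>) \<in> H" for a b \<beta>
      proof (cases "b < 0")
        case True
        then have "(- (a /\<^sub>R b), \<beta> / b) \<in> A" unfolding A_def using h by force
        from s[OF this] show ?thesis using conv[OF True, of a x s \<beta>] by simp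
      next
        case False
        have "a \<bullet> x + b * r \<le> \<beta>" using E[of x r] r h by auto
        moreover have "b * s \<le> b * r" using False \<open>s \<le> r\<close> by (intro mult_left_mono) auto
        ultimately show ?thesis by linarith
      qed
      then have "g x \<le> ereal s" unfolding E by auto
      then show ?thesis using r by simp
    qed
    show "\<exists>(p, \<alpha>)\<in>A. g x = ereal (p \<bullet> x + \<alpha>)"
    proof (rule ccontr)
      assume neg: "\<not> ?thesis"
      have strict: "p \<bullet> x + \<alpha> < r" if pA: "(p, \<alpha>) \<in> A" for p \<alpha>
      proof -
        obtain a b \<beta> where h: "((a, b), \<beta>) \<in> H" "b < 0" "p = - (a /\<^sub>R b)" "\<alpha> = \<beta> / b"
          using pA by (auto simp: A_def)
        have "a \<bullet> x + b * r \<le> \<beta>" using E[of x r] r h(1) by auto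
        then have "p \<bullet> x + \<alpha> \<le> r" using conv[OF h(2), of a x r \<beta>] unfolding h(3,4) by simp
        moreover have "p \<bullet> x + \<alpha> \<noteq> r" using neg pA r by auto
        ultimately show ?thesis by simp
      qed
      \<comment> \<open>The entry \<open>r - 1\<close> keeps the maximum defined, and below
        \<open>r\<close>, when \<open>A\<close> is empty.\<close>
      define s where "s = Max (insert (r - 1) ((\<lambda>(p, \<alpha>). p \<bullet> x + \<alpha>) ` A))"
      have "s < r" unfolding s_def using finA strict by (subst Max_less_iff) auto
      moreover have "p \<bullet> x + \<alpha> \<le> s" if "(p, \<alpha>) \<in> A" for p \<alpha>
        unfolding s_def using finA that by (intro Max_ge) force+
      ultimately show False using low[of s] by auto
    qed
  qed
qed

section \<open>Bounds for the convex envelope and the local extension\<close>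

lemma convex_envelope_ge:
  "affine_minorant f p \<alpha> \<Longrightarrow> ereal (p \<bullet> x + \<alpha>) \<le> convex_envelope f x"
  unfolding convex_envelope_def by (intro Sup_upper) auto

lemma convex_envelope_leI:
  assumes "\<And>p \<alpha>. affine_minorant f p \<alpha> \<Longrightarrow> ereal (p \<bullet> x + \<alpha>) \<le> c"
  shows "convex_envelope f x \<le> c"
  unfolding convex_envelope_def using assms by (intro Sup_least) auto

lemma convex_fun_convex_envelope: "convex_fun (convex_envelope f)"
  unfolding convex_fun_def
proof (intro allI impI convex_envelope_leI)
  fix x y :: "real ^ 'a" and t :: real and p \<alpha>
  assume t: "0 < t \<and> t < 1" and m: "affine_minorant f p \<alpha>"
  have "ereal (p \<bullet> ((1 - t) *\<^sub>R x + t *\<^sub>R y) + \<alpha>)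
      = ereal (1 - t) * ereal (p \<bullet> x + \<alpha>) + ereal t * ereal (p \<bullet> y + \<alpha>)"
    by (simp add: inner_simps algebra_simps)
  also have "\<dots> \<le> ereal (1 - t) * convex_envelope f x + ereal t * convex_envelope f y"
    using t m by (intro add_mono ereal_mult_left_mono convex_envelope_ge) auto
  finally show "ereal (p \<bullet> ((1 - t) *\<^sub>R x + t *\<^sub>R y) + \<alpha>)
      \<le> ereal (1 - t) * convex_envelope f x + ereal t * convex_envelope f y" .
qed

lemma convex_envelope_le_local_convex_ext: "convex_envelope f x \<le> local_convex_ext f x"
proof (rule convex_envelope_leI)
  fix p \<alpha> assume m: "affine_minorant f p \<alpha>"
  show "ereal (p \<bullet> x + \<alpha>) \<le> local_convex_ext f x"
    unfolding local_convex_ext_def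
  proof (rule Inf_greatest, clarify)
    fix c :: "int ^ 'a \<Rightarrow> real"
    assume c: "(\<Sum>y\<in>int_nbhd x. c y *\<^sub>R emb y) = x" "(\<Sum>y\<in>int_nbhd x. c y) = 1"
      "\<forall>y\<in>int_nbhd x. 0 \<le> c y"
    have "p \<bullet> x + \<alpha> = (\<Sum>y\<in>int_nbhd x. c y * (p \<bullet> emb y + \<alpha>))"
    proof -
      have "p \<bullet> x = (\<Sum>y\<in>int_nbhd x. c y * (p \<bullet> emb y))"
        by (subst c(1)[symmetric]) (simp add: inner_sum_right)
      moreover have "\<alpha> = (\<Sum>y\<in>int_nbhd x. c y * \<alpha>)" using c(2) by (simp add: sum_distrib_right[symmetric])
      ultimately show ?thesis by (simp add: distrib_left sum.distrib)
    qed
    then have "ereal (p \<bullet> x + \<alpha>) = (\<Sum>y\<in>int_nbhd x. ereal (c y) * ereal (p \<bullet> emb y + \<alpha>))"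
      by simp
    also have "\<dots> \<le> (\<Sum>y\<in>int_nbhd x. ereal (c y) * f y)"
      using c(3) m by (intro sum_mono ereal_mult_left_mono) (auto simp: affine_minorant_def)
    finally show "ereal (p \<bullet> x + \<alpha>) \<le> (\<Sum>y\<in>int_nbhd x. ereal (c y) * f y)" .
  qed
qed

text \<open>The weights of the hull representation, extended by 0 to all of
  \<open>int_nbhd x\<close>, are admissible in the infimum and yield the affine value.\<close>

lemma local_convex_ext_le_affine:
  assumes x: "x \<in> convex hull (emb ` (contact_set f p \<alpha> \<inter> int_nbhd x))"
  shows "local_convex_ext f x \<le> ereal (p \<bullet> x + \<alpha>)"
proof -
  let ?T = "contact_set f p \<alpha> \<inter> int_nbhd x"
  have finT: "finite ?T" using finite_int_nbhd by blast
  have inj: "inj_on emb ?T" by (auto intro: inj_onI)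
  obtain u where u: "\<forall>v\<in>emb ` ?T. 0 \<le> u v" "sum u (emb ` ?T) = 1" "(\<Sum>v\<in>emb ` ?T. u v *\<^sub>R v) = x"
    using x finT by (auto simp: convex_hull_finite)
  define c where "c y = (if y \<in> ?T then u (emb y) else 0)" for y
  have restr: "(\<Sum>y\<in>int_nbhd x. h y) = (\<Sum>y\<in>?T. h y)"
    if "\<And>y. y \<notin> ?T \<Longrightarrow> h y = 0" for h :: "int ^ 'a \<Rightarrow> 'b::comm_monoid_add"
    using that finite_int_nbhd[of x] by (intro sum.mono_neutral_right) auto
  have c1: "(\<Sum>y\<in>int_nbhd x. c y) = 1"
    using u(2) by (subst restr) (auto simp: c_def sum.reindex[OF inj])
  have cx: "(\<Sum>y\<in>int_nbhd x. c y *\<^sub>R emb y) = x"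
    using u(3) by (subst restr) (auto simp: c_def sum.reindex[OF inj])
  have "(\<Sum>y\<in>int_nbhd x. ereal (c y) * f y) = (\<Sum>y\<in>int_nbhd x. ereal (c y * (p \<bullet> emb y + \<alpha>)))"
    \<comment> \<open>Outside the contact set \<open>f\<close> may be infinite, but its coefficient
      there is 0 and \<open>0 * \<infinity> = 0\<close>.\<close>
    by (rule sum.cong) (auto simp: c_def contact_set_def zero_ereal_def[symmetric])
  also have "\<dots> = ereal (p \<bullet> x + \<alpha>)"
  proof -
    have "p \<bullet> x = (\<Sum>y\<in>int_nbhd x. c y * (p \<bullet> emb y))"
      by (subst cx[symmetric]) (simp add: inner_sum_right)
    moreover have "\<alpha> = (\<Sum>y\<in>int_nbhd x. c y * \<alpha>)" using c1 by (simp add: sum_distrib_right[symmetric])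
    ultimately show ?thesis by (simp add: distrib_left sum.distrib)
  qed
  finally have "ereal (p \<bullet> x + \<alpha>) = (\<Sum>y\<in>int_nbhd x. ereal (c y) * f y)" by simp
  then show ?thesis
    unfolding local_convex_ext_def using c1 cx u(1)
    by (intro Inf_lower) (auto intro!: exI[of _ c] simp: c_def)
qed

section \<open>The convex envelope and the local convex extension\<close>

text \<open>A hyperplane separating \<open>(x, t)\<close> from \<open>H\<close>, if not vertical, is
  the graph of an affine minorant exceeding \<open>t\<close> at \<open>x\<close>. A vertical one
  gives such a minorant after a large multiple of it is added to \<open>p0\<close>,
  \<open>\<alpha>0\<close>.\<close>

lemma convex_envelope_le_imp_in_closed_convex:
  assumes H: "closed H" "convex H" "(0, 1) \<in> rec_cone H"
    and graph: "\<And>y r. f y = ereal r \<Longrightarrow> (emb y, r) \<in> H"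
    and nm: "\<And>y. f y \<noteq> -\<infinity>" and dom: "edom f \<noteq> {}" and min: "affine_minorant f p0 \<alpha>0"
    and le: "convex_envelope f x \<le> ereal t"
  shows "(x, t) \<in> H"
proof (rule ccontr)
  assume "(x, t) \<notin> H"
  then obtain ac \<beta> where "ac \<bullet> (x, t) < \<beta>" "\<forall>y\<in>H. \<beta> < ac \<bullet> y"
    using separating_hyperplane_closed_point[OF H(2,1)] by blast
  then obtain a c where xt: "a \<bullet> x + c * t < \<beta>" and sep: "\<And>y s. (y, s) \<in> H \<Longrightarrow> \<beta> < a \<bullet> y + c * s"
    by (cases ac) (fastforce simp: inner_prod_def)
  obtain y0 r0 where y0: "f y0 = ereal r0"
  proof -
    obtain y where "f y < \<infinity>" using dom by (auto simp: edom_def)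
    then show ?thesis using that nm[of y] by (cases "f y") auto
  qed
  have c: "0 \<le> c"
  proof (rule ccontr)
    assume "\<not> 0 \<le> c"
    define k where "k = max 0 ((\<beta> - (a \<bullet> emb y0 + c * r0)) / c)"
    have "(emb y0, r0) + k *\<^sub>R (0, 1) \<in> H"
      by (intro rec_coneD[OF H(3)] graph y0) (simp add: k_def)
    then have "\<beta> < a \<bullet> emb y0 + c * (r0 + k)" using sep by auto
    moreover have "c * k \<le> \<beta> - (a \<bullet> emb y0 + c * r0)"
      using \<open>\<not> 0 \<le> c\<close> unfolding k_def by (auto simp: max_def field_simps)
    ultimately show False by (simp add: distrib_left)
  qed
  have env: "p \<bullet> x + \<alpha> \<le> t" if "affine_minorant f p \<alpha>" for p \<alpha>
    using order_trans[OF convex_envelope_ge[OF that, of x] le] by simp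
  have minI: "affine_minorant f p \<alpha>" if "\<And>y r. f y = ereal r \<Longrightarrow> p \<bullet> emb y + \<alpha> \<le> r" for p \<alpha>
    unfolding affine_minorant_def
  proof
    fix y show "ereal (p \<bullet> emb y + \<alpha>) \<le> f y"
      using that[of y] nm[of y] by (cases "f y") auto
  qed
  show False
  proof (cases "c = 0")
    case False
    have "affine_minorant f (- (a /\<^sub>R c)) (\<beta> / c)"
    proof (rule minI)
      fix y r assume "f y = ereal r"
      from sep[OF graph[OF this]] show "- (a /\<^sub>R c) \<bullet> emb y + \<beta> / c \<le> r"
        using False c by (simp add: field_simps)
    qed
    from env[OF this] show False using xt False c by (simp add: field_simps)
  next
    case True
    have ax: "0 < \<beta> - a \<bullet> x" using xt True by simp
    \<comment> \<open>With this factor the modified minorant is at least \<open>t + 1\<close> at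
      \<open>x\<close>; it stays below \<open>f\<close> because \<open>a\<close> exceeds
      \<open>\<beta>\<close> on the domain of \<open>f\<close>.\<close>
    define k where "k = max 0 ((t + 1 - (p0 \<bullet> x + \<alpha>0)) / (\<beta> - a \<bullet> x))"
    have "affine_minorant f (p0 - k *\<^sub>R a) (\<alpha>0 + k * \<beta>)"
    proof (rule minI)
      fix y r assume r: "f y = ereal r"
      have "p0 \<bullet> emb y + \<alpha>0 \<le> r" using min r unfolding affine_minorant_def by (metis ereal_less_eq(3))
      moreover have "k * \<beta> \<le> k * (a \<bullet> emb y)"
        using sep[OF graph[OF r]] True by (intro mult_left_mono) (auto simp: k_def)
      ultimately show "(p0 - k *\<^sub>R a) \<bullet> emb y + (\<alpha>0 + k * \<beta>) \<le> r" by (simp add: inner_diff_left)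
    qed
    from env[OF this] have "p0 \<bullet> x + \<alpha>0 + k * (\<beta> - a \<bullet> x) \<le> t"
      by (simp add: inner_diff_left algebra_simps)
    moreover have "t + 1 - (p0 \<bullet> x + \<alpha>0) \<le> k * (\<beta> - a \<bullet> x)"
      using ax unfolding k_def by (simp add: pos_divide_le_eq[symmetric])
    ultimately show False by linarith
  qed
qed

section \<open>Comparing the contact sets of two minorants\<close>

lemma emb_ray_in_image:
  assumes "\<And>z. z \<in> S \<Longrightarrow> z + w \<in> S" "z \<in> S"
  shows "emb z + real N *\<^sub>R emb w \<in> emb ` S"
proof (induction N)
  case (Suc N)
  then obtain y where y: "y \<in> S" "emb z + real N *\<^sub>R emb w = emb y" by blast
  then have "emb z + real (Suc N) *\<^sub>R emb w = emb (y + w)"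
    by (simp add: emb_add algebra_simps)
  then show ?case using assms(1)[OF y(1)] by blast
qed (use assms in simp)

text \<open>The first minorant is at most the second on the contact points of the second, hence on
  their hull. If the two agree at \<open>b\<close>, the level-face argument writes \<open>b\<close>
  by contact points where they agree, and these belong to both contact sets.\<close>

lemma hull_contact_set_graph_or_above:
  assumes m: "affine_minorant f p \<alpha>" and b: "b \<in> convex hull (emb ` contact_set f p' \<alpha>')"
  shows "(b, p' \<bullet> b + \<alpha>') \<in> graph_or_above p \<alpha> (convex hull (emb ` contact_set f p \<alpha>))"
proof -
  have ge: "\<alpha> - \<alpha>' \<le> (p' - p) \<bullet> y" if y: "y \<in> emb ` contact_set f p' \<alpha>'" for y
  proof -
    obtain z where z: "y = emb z" "f z = ereal (p' \<bullet> emb z + \<alpha>')" using y by (auto simp: contact_set_def)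
    have "ereal (p \<bullet> emb z + \<alpha>) \<le> f z" using m by (simp add: affine_minorant_def)
    then show ?thesis using z by (simp add: inner_diff_left)
  qed
  have "convex hull (emb ` contact_set f p' \<alpha>') \<subseteq> {y. (p' - p) \<bullet> y \<ge> \<alpha> - \<alpha>'}"
    using ge by (intro hull_minimal convex_halfspace_ge) auto
  then have bge: "(p' - p) \<bullet> b \<ge> \<alpha> - \<alpha>'" using b by blast
  show ?thesis
  proof (cases "(p' - p) \<bullet> b = \<alpha> - \<alpha>'")
    case False
    then show ?thesis using bge by (auto simp: graph_or_above_def inner_diff_left)
  next
    case True
    have "b \<in> convex hull {y \<in> emb ` contact_set f p' \<alpha>'. (p' - p) \<bullet> y = \<alpha> - \<alpha>'}"
      using True by (intro convex_hull_level_face ge b) auto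
    also have "\<dots> \<subseteq> convex hull (emb ` contact_set f p \<alpha>)"
    proof (intro hull_mono subsetI)
      fix y assume "y \<in> {y \<in> emb ` contact_set f p' \<alpha>'. (p' - p) \<bullet> y = \<alpha> - \<alpha>'}"
      then obtain z where z: "y = emb z" "f z = ereal (p' \<bullet> emb z + \<alpha>')" "(p' - p) \<bullet> emb z = \<alpha> - \<alpha>'"
        by (auto simp: contact_set_def)
      then have "p' \<bullet> emb z + \<alpha>' = p \<bullet> emb z + \<alpha>" by (simp add: inner_diff_left)
      then show "y \<in> emb ` contact_set f p \<alpha>" using z by (auto simp: contact_set_def)
    qed
    finally show ?thesis using True by (auto simp: graph_or_above_def inner_diff_left)
  qed
qed

text \<open>A minorant with larger slope along \<open>w\<close> would overtake the affine function
  of \<open>p'\<close>, \<open>\<alpha>'\<close> on a ray inside the hull of its contact set, where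
  it has to stay below.\<close>

lemma minorant_slope_le:
  assumes S: "integrally_convex_set (contact_set f p' \<alpha>')"
    and w: "emb w \<in> rec_cone (convex hull (emb ` contact_set f p' \<alpha>'))"
    and m: "affine_minorant f p \<alpha>"
  shows "p \<bullet> emb w \<le> p' \<bullet> emb w"
proof (rule ccontr)
  assume "\<not> ?thesis"
  then have pos: "0 < (p - p') \<bullet> emb w" by (simp add: inner_diff_left)
  obtain z where z: "z \<in> contact_set f p' \<alpha>'" using S by (auto simp: integrally_convex_set_def)
  let ?gap = "\<lambda>y. (p' \<bullet> y + \<alpha>') - (p \<bullet> y + \<alpha>)"
  obtain N :: nat where N: "?gap (emb z) < N * ((p - p') \<bullet> emb w)"
    using reals_Archimedean3[OF pos] by blast
  have "emb z + real N *\<^sub>R emb w \<in> convex hull (emb ` contact_set f p' \<alpha>')"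
    using z by (intro rec_coneD[OF w]) (auto simp: hull_inc)
  from hull_contact_set_graph_or_above[OF m this] have "0 \<le> ?gap (emb z + real N *\<^sub>R emb w)"
    by (auto simp: graph_or_above_def)
  then show False using N by (simp add: inner_simps algebra_simps)
qed

text \<open>The set \<open>H\<close> built below contains the epigraph of the envelope and lies in
  \<open>graph_or_above\<close> for the tight minorant. There
  \<open>(x, p \<bullet> x + \<alpha>)\<close> is a boundary point, so \<open>x\<close> is in the
  hull.\<close>

lemma in_hull_contact_set_if_tight:
  fixes f :: "int ^ 'n::finite \<Rightarrow> ereal"
  assumes nm: "\<And>y. f y \<noteq> -\<infinity>" and dom: "edom f \<noteq> {}"
    and poly: "polyhedral_convex_fun (convex_envelope f)"
    and env: "\<And>y. convex_envelope f (emb y) = f y"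
    and ic: "\<And>p \<alpha>. affine_minorant f p \<alpha> \<Longrightarrow> contact_set f p \<alpha> \<noteq> {} \<Longrightarrow>
      integrally_convex_set (contact_set f p \<alpha>)"
    and m: "affine_minorant f p \<alpha>" and tight: "convex_envelope f x = ereal (p \<bullet> x + \<alpha>)"
  shows "x \<in> convex hull (emb ` contact_set f p \<alpha>)"
proof -
  let ?hull = "\<lambda>c. convex hull (emb ` contact_set f (fst c) (snd c))"
  have "convex_envelope f y \<noteq> -\<infinity>" for y using convex_envelope_ge[OF m, of y] by auto
  then obtain A where A: "finite A" "\<And>p \<alpha> y. (p, \<alpha>) \<in> A \<Longrightarrow> ereal (p \<bullet> y + \<alpha>) \<le> convex_envelope f y"
    and Aeq: "\<And>y. convex_envelope f y \<noteq> \<infinity> \<Longrightarrow> \<exists>(p, \<alpha>)\<in>A. convex_envelope f y = ereal (p \<bullet> y + \<alpha>)"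
    using polyhedral_max_affine[OF poly] by metis
  \<comment> \<open>Pieces without contact points are dropped because \<open>ic\<close> says nothing
    of them; every point of the domain of \<open>f\<close> is still a contact point of a remaining
    piece.\<close>
  define A' where "A' = {c \<in> A. contact_set f (fst c) (snd c) \<noteq> {}}"
  have finA': "finite A'" using A(1) by (simp add: A'_def)
  have icA: "integrally_convex_set (contact_set f (fst c) (snd c))" if "c \<in> A'" for c
  proof (rule ic)
    show "affine_minorant f (fst c) (snd c)"
      using A(2)[of "fst c" "snd c" "emb _"] that by (auto simp: affine_minorant_def A'_def env)
  qed (use that in \<open>simp add: A'_def\<close>)
  have "\<exists>B W. finite B \<and> B \<subseteq> ?hull c \<and> finite W \<and> emb ` W \<subseteq> rec_cone (?hull c) \<and>
      (\<forall>y\<in>?hull c. \<exists>b\<in>convex hull B. \<exists>r\<in>convex_cone hull (emb ` W). y = b + r)"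
    if "c \<in> A'" for c
    using integrally_convex_hull_decomposition[OF icA[OF that]] by metis
  then obtain B W where BW: "\<And>c. c \<in> A' \<Longrightarrow> finite (B c) \<and> B c \<subseteq> ?hull c \<and> finite (W c) \<and>
      emb ` W c \<subseteq> rec_cone (?hull c) \<and>
      (\<forall>y\<in>?hull c. \<exists>b\<in>convex hull (B c). \<exists>r\<in>convex_cone hull (emb ` W c). y = b + r)"
    by metis
  \<comment> \<open>Base points and recession directions are lifted to the graph of their piece;
    \<open>(0, 1)\<close> adds the upward direction.\<close>
  define BB where "BB = (\<Union>c\<in>A'. (\<lambda>b. (b, fst c \<bullet> b + snd c)) ` B c)"
  define WW where "WW = insert (0, 1) (\<Union>c\<in>A'. (\<lambda>w. (emb w, fst c \<bullet> emb w)) ` W c)"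
  define H where "H = {b + w | b w. b \<in> convex hull BB \<and> w \<in> convex_cone hull WW}"
  have fin: "finite BB" "finite WW" using finA' BW by (auto simp: BB_def WW_def)
  have H: "closed H" "convex H" "(0, 1) \<in> rec_cone H"
    unfolding H_def using closed_convex_hull_plus_cone[OF fin]
      rec_cone_convex_hull_plus_cone[of "(0, 1)" WW BB] by (simp_all add: WW_def)
  have graph: "(emb y, r) \<in> H" if y: "f y = ereal r" for y r
  proof -
    obtain c where c: "c \<in> A" "f y = ereal (fst c \<bullet> emb y + snd c)"
      using Aeq[of "emb y"] y env by fastforce
    then have yc: "y \<in> contact_set f (fst c) (snd c)" by (simp add: contact_set_def)
    then have cA: "c \<in> A'" using c(1) by (auto simp: A'_def)
    have "emb y \<in> ?hull c" using yc by (simp add: hull_inc)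
    then obtain b w where bw: "b \<in> convex hull (B c)" "w \<in> convex_cone hull (emb ` W c)" "emb y = b + w"
      using BW[OF cA] by blast
    have "convex hull (B c) \<subseteq> {b. (b, fst c \<bullet> b + snd c) \<in> convex hull BB}"
    proof (rule hull_minimal)
      show "B c \<subseteq> {b. (b, fst c \<bullet> b + snd c) \<in> convex hull BB}"
        using cA by (auto simp: BB_def intro!: hull_inc)
      have eq: "((1 - t) *\<^sub>R u + t *\<^sub>R v, fst c \<bullet> ((1 - t) *\<^sub>R u + t *\<^sub>R v) + snd c)
          = (1 - t) *\<^sub>R (u, fst c \<bullet> u + snd c) + t *\<^sub>R (v, fst c \<bullet> v + snd c)" for t u v
        by (simp add: inner_simps algebra_simps)
      show "convex {b. (b, fst c \<bullet> b + snd c) \<in> convex hull BB}"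
        unfolding convex_alt mem_Collect_eq eq
        using convex_convex_hull[of BB] unfolding convex_alt by blast
    qed
    moreover have "convex_cone hull (emb ` W c) \<subseteq> {w. (w, fst c \<bullet> w) \<in> convex_cone hull WW}"
    proof (rule hull_minimal)
      show "emb ` W c \<subseteq> {w. (w, fst c \<bullet> w) \<in> convex_cone hull WW}"
        using cA by (auto simp: WW_def intro!: hull_inc)
      show "convex_cone {w. (w, fst c \<bullet> w) \<in> convex_cone hull WW}"
      proof (rule convex_cone_iff[THEN iffD2], intro conjI ballI allI impI CollectI)
        show "(0, fst c \<bullet> 0) \<in> convex_cone hull WW"
          using convex_cone_hull_contains_0[of WW] by (simp add: zero_prod_def)
      next
        fix u v assume "u \<in> {w. (w, fst c \<bullet> w) \<in> convex_cone hull WW}"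
          "v \<in> {w. (w, fst c \<bullet> w) \<in> convex_cone hull WW}"
        then show "(u + v, fst c \<bullet> (u + v)) \<in> convex_cone hull WW"
          using convex_cone_hull_add[of "(u, fst c \<bullet> u)" WW "(v, fst c \<bullet> v)"] by (simp add: inner_add_right)
      next
        fix u and t :: real assume "u \<in> {w. (w, fst c \<bullet> w) \<in> convex_cone hull WW}" "0 \<le> t"
        then show "(t *\<^sub>R u, fst c \<bullet> t *\<^sub>R u) \<in> convex_cone hull WW"
          using convex_cone_hull_mul[of "(u, fst c \<bullet> u)" WW t] by simp
      qed
    qed
    ultimately have "(b, fst c \<bullet> b + snd c) \<in> convex hull BB" "(w, fst c \<bullet> w) \<in> convex_cone hull WW"
      using bw by auto
    moreover have "(emb y, r) = (b, fst c \<bullet> b + snd c) + (w, fst c \<bullet> w)"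
      using y c(2) bw(3) by (simp add: inner_add_right)
    ultimately show ?thesis unfolding H_def by blast
  qed
  let ?C = "convex hull (emb ` contact_set f p \<alpha>)"
  have "(x, p \<bullet> x + \<alpha>) \<in> H"
    using convex_envelope_le_imp_in_closed_convex[OF H graph nm dom m] tight by simp
  then obtain b w where bw: "b \<in> convex hull BB" "w \<in> convex_cone hull WW" "(x, p \<bullet> x + \<alpha>) = b + w"
    unfolding H_def by blast
  have "b + w \<in> graph_or_above p \<alpha> ?C"
  proof (rule convex_hull_plus_cone_subset[OF _ _ _ bw(1,2)])
    show "convex (graph_or_above p \<alpha> ?C)" by (simp add: convex_graph_or_above)
    show "BB \<subseteq> graph_or_above p \<alpha> ?C"
      unfolding BB_def using BW hull_contact_set_graph_or_above[OF m] by blast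
    show "WW \<subseteq> rec_cone (graph_or_above p \<alpha> ?C)"
    proof
      fix v assume "v \<in> WW"
      then consider "v = (0, 1)" | c w where "c \<in> A'" "w \<in> W c" "v = (emb w, fst c \<bullet> emb w)"
        by (auto simp: WW_def)
      then show "v \<in> rec_cone (graph_or_above p \<alpha> ?C)"
      proof cases
        case 1
        then show ?thesis using graph_or_above_rec_cone[of p 0 1 ?C \<alpha>] by simp
      next
        case 2
        have wrec: "emb w \<in> rec_cone (?hull c)" using BW[OF 2(1)] 2(2) by blast
        note slope = minorant_slope_le[OF icA[OF 2(1)] wrec]
        show ?thesis
          unfolding 2(3)
        proof (rule graph_or_above_rec_cone[OF slope[OF m]])
          assume pw: "p \<bullet> emb w = fst c \<bullet> emb w"
          \<comment> \<open>No minorant has a larger slope along \<open>w\<close> than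
            \<open>c\<close>, whose slope is that of \<open>p\<close>. So at \<open>z + w\<close> no
            minorant exceeds the tight one, and \<open>env\<close> turns this into a bound on
            \<open>f\<close>.\<close>
          have step: "z + w \<in> contact_set f p \<alpha>" if z: "z \<in> contact_set f p \<alpha>" for z
          proof -
            have "convex_envelope f (emb (z + w)) \<le> ereal (p \<bullet> emb (z + w) + \<alpha>)"
            proof (rule convex_envelope_leI)
              fix q \<beta> assume q: "affine_minorant f q \<beta>"
              then have "ereal (q \<bullet> emb z + \<beta>) \<le> f z" by (simp add: affine_minorant_def)
              then have "q \<bullet> emb z + \<beta> \<le> p \<bullet> emb z + \<alpha>" using z by (simp add: contact_set_def)
              then show "ereal (q \<bullet> emb (z + w) + \<beta>) \<le> ereal (p \<bullet> emb (z + w) + \<alpha>)"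
                using slope[OF q] pw by (simp add: emb_add inner_add_right)
            qed
            moreover have "ereal (p \<bullet> emb (z + w) + \<alpha>) \<le> f (z + w)"
              using m by (simp add: affine_minorant_def)
            ultimately show ?thesis using env[of "z + w"] by (simp add: contact_set_def)
          qed
          show "emb w \<in> rec_cone ?C"
          \<comment> \<open>That the contact set is nonempty follows only from the conclusion; for
            the empty set \<open>rec_cone\<close> is everything.\<close>
          proof (cases "contact_set f p \<alpha> = {}")
            case True
            then show ?thesis by (simp add: rec_cone_def)
          next
            case False
            then obtain z where z: "z \<in> contact_set f p \<alpha>" by blast
            show ?thesis
            proof (rule rec_cone_if_ray[OF closed_integrally_convex_hull[OF ic[OF m False]] convex_convex_hull])
              show "emb z \<in> ?C" using z by (simp add: hull_inc)
              show "emb z + real N *\<^sub>R emb w \<in> ?C" for N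
                using emb_ray_in_image[OF step z] by (simp add: hull_inc)
            qed
          qed
        qed
      qed
    qed
  qed
  then show ?thesis unfolding bw(3)[symmetric] by (simp add: graph_or_above_def)
qed

text \<open>An affine piece tight at \<open>x\<close> has \<open>x\<close> in the hull of its
  contact set. Integral convexity of that set localises this to contact points near
  \<open>x\<close>, which bounds the local extension by the piece.\<close>

lemma local_convex_ext_eq_convex_envelope:
  fixes f :: "int ^ 'n::finite \<Rightarrow> ereal"
  assumes nm: "\<And>y. f y \<noteq> -\<infinity>" and dom: "edom f \<noteq> {}" and m0: "affine_minorant f p0 \<alpha>0"
    and poly: "polyhedral_convex_fun (convex_envelope f)"
    and env: "\<And>y. convex_envelope f (emb y) = f y"
    and ic: "\<And>p \<alpha>. affine_minorant f p \<alpha> \<Longrightarrow> contact_set f p \<alpha> \<noteq> {} \<Longrightarrow>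
      integrally_convex_set (contact_set f p \<alpha>)"
  shows "local_convex_ext f x = convex_envelope f x"
proof (rule antisym[OF _ convex_envelope_le_local_convex_ext])
  show "local_convex_ext f x \<le> convex_envelope f x"
  proof (cases "convex_envelope f x = \<infinity>")
    case False
    have "convex_envelope f y \<noteq> -\<infinity>" for y using convex_envelope_ge[OF m0, of y] by auto
    then obtain A where A: "\<And>p \<alpha> y. (p, \<alpha>) \<in> A \<Longrightarrow> ereal (p \<bullet> y + \<alpha>) \<le> convex_envelope f y"
      and Aeq: "\<And>y. convex_envelope f y \<noteq> \<infinity> \<Longrightarrow> \<exists>(p, \<alpha>)\<in>A. convex_envelope f y = ereal (p \<bullet> y + \<alpha>)"
      using polyhedral_max_affine[OF poly] by metis
    obtain p \<alpha> where tight: "convex_envelope f x = ereal (p \<bullet> x + \<alpha>)"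
      and le: "\<And>y. ereal (p \<bullet> y + \<alpha>) \<le> convex_envelope f y"
      using Aeq[OF False] A by blast
    have m: "affine_minorant f p \<alpha>" using le[of "emb _"] by (simp add: affine_minorant_def env)
    have x: "x \<in> convex hull (emb ` contact_set f p \<alpha>)"
      by (rule in_hull_contact_set_if_tight[OF nm dom poly env ic m tight])
    then have "contact_set f p \<alpha> \<noteq> {}" by auto
    from ic[OF m this] x have "x \<in> convex hull (emb ` (contact_set f p \<alpha> \<inter> int_nbhd x))"
      unfolding integrally_convex_set_def by blast
    from local_convex_ext_le_affine[OF this] show ?thesis by (simp add: tight)
  qed simp
qed

text \<open>Attainment of the infimum is expressed by closedness of \<open>H\<close>, the points on
  or above the hull of the local graph: it contains \<open>(x, t)\<close> for every \<open>t\<close>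
  above the affine value, hence for that value too. As \<open>H\<close> lies in
  \<open>graph_or_above\<close>, only contact points are involved.\<close>

lemma in_hull_contact_set_if_local_convex_ext_le:
  fixes f :: "int ^ 'n::finite \<Rightarrow> ereal"
  assumes nm: "\<And>y. f y \<noteq> -\<infinity>" and m: "affine_minorant f p \<alpha>"
    and le: "local_convex_ext f x \<le> ereal (p \<bullet> x + \<alpha>)"
  shows "x \<in> convex hull (emb ` (contact_set f p \<alpha> \<inter> int_nbhd x))"
proof -
  define r where "r y = real_of_ereal (f y)" for y
  define G where "G = (\<lambda>y. (emb y, r y)) ` {y \<in> int_nbhd x. f y \<noteq> \<infinity>}"
  define H where "H = {b + w | b w. b \<in> convex hull G \<and> w \<in> convex_cone hull {(0, 1)}}"
  have r: "f y = ereal (r y)" if "f y \<noteq> \<infinity>" for y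
    using that nm[of y] by (cases "f y") (auto simp: r_def)
  have "finite G" unfolding G_def using finite_int_nbhd[of x] by auto
  then have closed: "closed H" unfolding H_def by (intro closed_convex_hull_plus_cone) auto
  have above: "(x, t) \<in> H" if t: "p \<bullet> x + \<alpha> < t" for t
  proof -
    have "local_convex_ext f x < ereal t" using le t by (auto intro: le_less_trans)
    then obtain c :: "int ^ 'n \<Rightarrow> real" where
      c: "(\<Sum>y\<in>int_nbhd x. c y *\<^sub>R emb y) = x" "(\<Sum>y\<in>int_nbhd x. c y) = 1"
        "\<forall>y\<in>int_nbhd x. 0 \<le> c y" and lt: "(\<Sum>y\<in>int_nbhd x. ereal (c y) * f y) < ereal t"
      unfolding local_convex_ext_def Inf_less_iff by blast
    \<comment> \<open>A point of infinite value with positive weight would make the whole sum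
      infinite.\<close>
    have fin: "f y \<noteq> \<infinity>" if y: "y \<in> int_nbhd x" "c y \<noteq> 0" for y
    proof
      assume "f y = \<infinity>"
      then have "ereal (c y) * f y = \<infinity>" using c(3) y by (auto simp: less_le)
      then have "(\<Sum>y\<in>int_nbhd x. ereal (c y) * f y) = \<infinity>"
        unfolding sum_Pinfty using y(1) finite_int_nbhd by blast
      then show False using lt by simp
    qed
    let ?Y = "{y \<in> int_nbhd x. f y \<noteq> \<infinity>}"
    have restr: "(\<Sum>y\<in>int_nbhd x. h y) = (\<Sum>y\<in>?Y. h y)"
      if "\<And>y. c y = 0 \<Longrightarrow> h y = 0" for h :: "int ^ 'n \<Rightarrow> 'b::comm_monoid_add"
      using that fin finite_int_nbhd[of x] by (intro sum.mono_neutral_right) auto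
    have "(\<Sum>y\<in>int_nbhd x. ereal (c y) * f y) = (\<Sum>y\<in>?Y. ereal (c y) * f y)"
      by (rule restr) (simp add: zero_ereal_def[symmetric])
    also have "\<dots> = ereal (\<Sum>y\<in>?Y. c y * r y)"
      unfolding sum_ereal[symmetric] by (rule sum.cong) (auto simp: r)
    finally have s: "(\<Sum>y\<in>?Y. c y * r y) < t" using lt by simp
    have "(\<Sum>y\<in>?Y. c y *\<^sub>R (emb y, r y)) \<in> convex hull G"
    proof (rule convex_sum[OF _ convex_convex_hull])
      show "finite ?Y" using finite_int_nbhd[of x] by simp
      show "(\<Sum>y\<in>?Y. c y) = 1" using c(2) restr[of c] by simp
      show "(emb y, r y) \<in> convex hull G" if "y \<in> ?Y" for y
        using that by (intro hull_inc) (auto simp: G_def)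
    qed (use c(3) in auto)
    moreover have "(\<Sum>y\<in>?Y. c y *\<^sub>R (emb y, r y)) = (x, \<Sum>y\<in>?Y. c y * r y)"
      using c(1) restr[of "\<lambda>y. c y *\<^sub>R emb y"] by (simp add: prod_eq_iff fst_sum snd_sum)
    moreover have "(t - (\<Sum>y\<in>?Y. c y * r y)) *\<^sub>R (0, 1) \<in> convex_cone hull {(0 :: real ^ 'n, 1 :: real)}"
      using s by (intro convex_cone_hull_mul hull_inc) auto
    moreover have "(x, t) = (x, \<Sum>y\<in>?Y. c y * r y) + (t - (\<Sum>y\<in>?Y. c y * r y)) *\<^sub>R (0, 1)"
      by simp
    ultimately show ?thesis unfolding H_def by (metis (mono_tags, lifting) mem_Collect_eq)
  qed
  have "(\<lambda>k. (x, p \<bullet> x + \<alpha> + inverse (real (Suc k)))) \<longlonglongrightarrow> (x, p \<bullet> x + \<alpha> + 0)"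
    by (intro tendsto_intros LIMSEQ_inverse_real_of_nat)
  then have "(x, p \<bullet> x + \<alpha>) \<in> H"
    using closed_sequentially[OF closed, of "\<lambda>k. (x, p \<bullet> x + \<alpha> + inverse (real (Suc k)))"] above by simp
  then obtain b w where bw: "b \<in> convex hull G" "w \<in> convex_cone hull {(0, 1)}" "(x, p \<bullet> x + \<alpha>) = b + w"
    unfolding H_def by blast
  let ?C = "convex hull (emb ` (contact_set f p \<alpha> \<inter> int_nbhd x))"
  have "b + w \<in> graph_or_above p \<alpha> ?C"
  proof (rule convex_hull_plus_cone_subset[OF _ _ _ bw(1,2)])
    show "convex (graph_or_above p \<alpha> ?C)" by (simp add: convex_graph_or_above)
    show "{(0, 1)} \<subseteq> rec_cone (graph_or_above p \<alpha> ?C)"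
      using graph_or_above_rec_cone[of p 0 1 ?C \<alpha>] by simp
    show "G \<subseteq> graph_or_above p \<alpha> ?C"
    proof
      fix v assume "v \<in> G"
      then obtain y where y: "y \<in> int_nbhd x" "f y = ereal (r y)" "v = (emb y, r y)"
        using r by (auto simp: G_def)
      have "ereal (p \<bullet> emb y + \<alpha>) \<le> f y" using m by (simp add: affine_minorant_def)
      then have "p \<bullet> emb y + \<alpha> \<le> r y" using y(2) by simp
      moreover have "emb y \<in> ?C" if "r y = p \<bullet> emb y + \<alpha>"
        using that y by (intro hull_inc) (auto simp: contact_set_def)
      ultimately show "v \<in> graph_or_above p \<alpha> ?C" using y(3) by (auto simp: graph_or_above_def)
    qed
  qed
  then show ?thesis unfolding bw(3)[symmetric] by (simp add: graph_or_above_def)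
qed

text \<open>The points where the local extension is at most the affine function form a convex set.
  It contains every contact point, since each lies in its own neighbourhood, and therefore their
  hull.\<close>

lemma integrally_convex_contact_set:
  fixes f :: "int ^ 'n::finite \<Rightarrow> ereal"
  assumes nm: "\<And>y. f y \<noteq> -\<infinity>" and f: "integrally_convex_fun f"
    and m: "affine_minorant f p \<alpha>" and ne: "contact_set f p \<alpha> \<noteq> {}"
  shows "integrally_convex_set (contact_set f p \<alpha>)"
  unfolding integrally_convex_set_def
proof (intro conjI ne ballI in_hull_contact_set_if_local_convex_ext_le[OF nm m])
  fix x assume x: "x \<in> convex hull (emb ` contact_set f p \<alpha>)"
  have "convex hull (emb ` contact_set f p \<alpha>) \<subseteq> {x. local_convex_ext f x \<le> ereal (p \<bullet> x + \<alpha>)}"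
  proof (rule hull_minimal)
    show "emb ` contact_set f p \<alpha> \<subseteq> {x. local_convex_ext f x \<le> ereal (p \<bullet> x + \<alpha>)}"
    proof clarify
      fix z assume "z \<in> contact_set f p \<alpha>"
      then have "emb z \<in> emb ` (contact_set f p \<alpha> \<inter> int_nbhd (emb z))" by (simp add: int_nbhd_def)
      then show "local_convex_ext f (emb z) \<le> ereal (p \<bullet> emb z + \<alpha>)"
        by (intro local_convex_ext_le_affine hull_inc)
    qed
    show "convex {x. local_convex_ext f x \<le> ereal (p \<bullet> x + \<alpha>)}"
      unfolding convex_alt
    proof (intro ballI allI impI CollectI)
      fix x y and t :: real
      assume x: "x \<in> {x. local_convex_ext f x \<le> ereal (p \<bullet> x + \<alpha>)}"
        and y: "y \<in> {x. local_convex_ext f x \<le> ereal (p \<bullet> x + \<alpha>)}" and t: "0 \<le> t \<and> t \<le> 1"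
      show "local_convex_ext f ((1 - t) *\<^sub>R x + t *\<^sub>R y) \<le> ereal (p \<bullet> ((1 - t) *\<^sub>R x + t *\<^sub>R y) + \<alpha>)"
      \<comment> \<open>\<open>convex_fun\<close> speaks only of \<open>0 < t < 1\<close>, so the
        endpoints are treated apart.\<close>
      proof (cases "t = 0 \<or> t = 1")
        case True
        then show ?thesis using x y by auto
      next
        case False
        then have "local_convex_ext f ((1 - t) *\<^sub>R x + t *\<^sub>R y)
            \<le> ereal (1 - t) * local_convex_ext f x + ereal t * local_convex_ext f y"
          using f t unfolding integrally_convex_fun_def convex_fun_def by auto
        also have "\<dots> \<le> ereal (1 - t) * ereal (p \<bullet> x + \<alpha>) + ereal t * ereal (p \<bullet> y + \<alpha>)"
          using t x y by (intro add_mono ereal_mult_left_mono) auto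
        also have "\<dots> = ereal (p \<bullet> ((1 - t) *\<^sub>R x + t *\<^sub>R y) + \<alpha>)"
          by (simp add: inner_simps algebra_simps)
        finally show ?thesis .
      qed
    qed
  qed
  then show "local_convex_ext f x \<le> ereal (p \<bullet> x + \<alpha>)" using x by blast
qed

theorem theorem4p4:
  fixes f :: "int ^ 'n::finite \<Rightarrow> ereal"
  assumes "\<And>x. f x \<noteq> -\<infinity>"
    and "edom f \<noteq> {}"
    and "\<exists>p \<alpha>. affine_minorant f p \<alpha>"
    and "polyhedral_convex_fun (convex_envelope f)"
    and "\<And>x. convex_envelope f (emb x) = f x"
  shows "integrally_convex_fun f \<longleftrightarrow>
    (\<forall>p :: real ^ 'n. attains_finite_min (tilt f p) \<longrightarrow>
        integrally_convex_set (argmin_set (tilt f p)))"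
  unfolding integrally_convex_argmin_iff
proof (intro iffI allI impI)
  fix p \<alpha>
  assume "integrally_convex_fun f" "affine_minorant f p \<alpha>" "contact_set f p \<alpha> \<noteq> {}"
  then show "integrally_convex_set (contact_set f p \<alpha>)"
    using integrally_convex_contact_set assms(1) by blast
next
  assume ic: "\<forall>p \<alpha>. affine_minorant f p \<alpha> \<longrightarrow> contact_set f p \<alpha> \<noteq> {} \<longrightarrow>
    integrally_convex_set (contact_set f p \<alpha>)"
  obtain p0 \<alpha>0 where "affine_minorant f p0 \<alpha>0" using assms(3) by blast
  then have "local_convex_ext f x = convex_envelope f x" for x
    using local_convex_ext_eq_convex_envelope assms ic by blast
  then have "local_convex_ext f = convex_envelope f" by blast
  then show "integrally_convex_fun f"
    by (simp add: integrally_convex_fun_def convex_fun_convex_envelope)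
qed

end
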